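(* In the setting described in the context (a random environment $(\Omega,\Pi,\{\tau_z\}_{z\in\mathbb{Z}^d})$ with transition matrix $p=p(\omega)$ that is bistochastic, of finite range, with zero local drift, ergodic, and almost surely irreducible), let $(\mathcal{M},\mu,T)$ be the associated point-of-view-of-the-particle dynamical system and let $D$ be the displacement function. Then the stochastic process $\{X_n\}_{n\in\mathbb{N}}$ on the probability space $(\mathcal{M},\mu)$ defined by $X_0:=0$ and $X_n:=\sum_{k=0}^{n-1} D\circ T^k$ for $n\ge 1$ satisfies the Central Limit Theorem with mean zero and covariance matrix $C=\{c_{\alpha\beta}\}_{\alpha,\beta=1}^d$, where $$c_{\alpha\beta}:=\int_{\mathcal{M}} D^{(\alpha)}(s,\omega)\,D^{(\beta)}(s,\omega)\;\mu(ds\,d\omega),$$ $D^{(\alpha)}$ denoting the $\alpha$-th component of the vector $D$. That is, with respect to $\mu$, $X_n/\sqrt{n}$ converges in distribution, as $n\to\infty$, to the (possibly degenerate) centered Gaussian law on $\mathbb{R}^d$ with covariance matrix $C$.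
   Context: Random environment. Let $d\ge 1$ and let $(\Omega,\Pi)$ be a probability space acted upon by a group $\{\tau_z\}_{z\in\mathbb{Z}^d}$ of $\Pi$-preserving automorphisms (a measure-preserving action of $\mathbb{Z}^d$), and assume the action is ergodic. To each $\omega\in\Omega$ there corresponds (measurably) a matrix $p(\omega)=\{p_{xy}(\omega)\}_{x,y\in\mathbb{Z}^d}$ of nonnegative numbers such that: (i) (bistochasticity) $\sum_{y\in\mathbb{Z}^d}p_{xy}=1$ for all $x\in\mathbb{Z}^d$, and $\sum_{x\in\mathbb{Z}^d}p_{xy}=1$ for all $y\in\mathbb{Z}^d$; (ii) (finite range) there is a finite set $\Lambda\subset\mathbb{Z}^d$ (independent of $\omega$) with $p_{xy}=0$ whenever $y-x\notin\Lambda$; (iii) (zero local drift) $\sum_{y\in\mathbb{Z}^d}(y-x)\,p_{xy}=0$ for all $x\in\mathbb{Z}^d$; (iv) (covariance) $p_{xy}(\tau_z\omega)=p_{x+z,y+z}(\omega)$ for all $x,y,z\in\mathbb{Z}^d$; (v) (almost sure irreducibility) for $\Pi$-a.e. $\omega$ and every $y\in\mathbb{Z}^d$ there exists $n=n(\omega,y)$ such that $p^{(n)}_{0y}:=\sum_{x_1,\ldots,x_{n-1}}p_{0x_1}p_{x_1x_2}\cdots p_{x_{n-1}y}>0$. Point-of-view-of-the-particle dynamical system. Enumerate $\Lambda=\{d_1,\ldots,d_N\}$. For $\omega\in\Omega$ and $i=1,\ldots,N$ set $q_i(\omega):=p_{0d_i}(\omega)$, $a_0:=0$, $a_i(\omega):=a_{i-1}(\omega)+q_i(\omega)$,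 $I_i(\omega):=[a_{i-1}(\omega),a_i(\omega))$. The (possibly empty) intervals $I_1(\omega),\ldots,I_N(\omega)$ partition $I:=[0,1)$. For $(s,\omega)\in I\times\Omega$ let $i(s,\omega)$ be the unique $i$ with $s\in I_i(\omega)$, and define the displacement function $D(s,\omega):=d_{i(s,\omega)}\in\Lambda$ and the internal dynamics $\phi(s,\omega):=q_{i(s,\omega)}(\omega)^{-1}\left(s-a_{i(s,\omega)-1}(\omega)\right)\in I$. Let $\mathcal{M}:=I\times\Omega$, $\mu:=m\times\Pi$ where $m$ is Lebesgue measure on $I$, and $T:\mathcal{M}\to\mathcal{M}$, $T(s,\omega):=\left(\phi(s,\omega),\tau_{D(s,\omega)}(\omega)\right)$. (Under $\mu$, the process $\{X_n\}$ has the annealed law of the random walk in random environment started at $0$: first $\omega$ is chosen with law $\Pi$, then the walk is the Markov chain with transition probabilities $p_{xy}(\omega)$.) *)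

theory Defs
  imports "HOL-Probability.Probability"
begin

section \<open>Stationary ergodic random environments on \<open>\<int>\<^sup>d\<close>\<close>

text \<open>The lattice \<open>\<int>\<^sup>d\<close> is the type \<^typ>\<open>int ^ 'd\<close> over a finite index type \<open>'d\<close>.\<close>

definition real_vec :: "int ^ 'd \<Rightarrow> real ^ 'd" where
  "real_vec z = (\<chi> \<alpha>. real_of_int (z $ \<alpha>))"

definition mp_action :: "'w measure \<Rightarrow> (int ^ 'd \<Rightarrow> 'w \<Rightarrow> 'w) \<Rightarrow> bool" where
  "mp_action P \<tau> \<longleftrightarrow>
     (\<forall>z. \<tau> z \<in> measurable P P \<and> distr P P (\<tau> z) = P) \<and>
     (\<forall>\<omega>\<in>space P. \<tau> 0 \<omega> = \<omega>) \<and>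
     (\<forall>y z. \<forall>\<omega>\<in>space P. \<tau> (y + z) \<omega> = \<tau> y (\<tau> z \<omega>))"

definition ergodic_action :: "'w measure \<Rightarrow> (int ^ 'd \<Rightarrow> 'w \<Rightarrow> 'w) \<Rightarrow> bool" where
  "ergodic_action P \<tau> \<longleftrightarrow>
     (\<forall>A\<in>sets P. (\<forall>z. \<tau> z -` A \<inter> space P = A) \<longrightarrow> measure P A = 0 \<or> measure P A = 1)"

text \<open>The sum over all intermediate points \<open>x\<^sub>1, \<dots>, x\<^sub>n\<^sub>-\<^sub>1\<close> (the list \<open>xs\<close>); only meaningful
  for \<open>n \<ge> 1\<close>.\<close>

definition n_step :: "(int ^ 'd \<Rightarrow> int ^ 'd \<Rightarrow> real) \<Rightarrow> nat \<Rightarrow> int ^ 'd \<Rightarrow> int ^ 'd \<Rightarrow> real" where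
  "n_step q n x y =
     (\<Sum>\<^sub>\<infinity>xs\<in>{xs. length xs = n - 1}.
        \<Prod>k<n. q ((x # xs @ [y]) ! k) ((x # xs @ [y]) ! Suc k))"

locale random_environment = prob_space P
  for P :: "'w measure"
    and \<tau> :: "int ^ 'd \<Rightarrow> 'w \<Rightarrow> 'w"
    and p :: "'w \<Rightarrow> int ^ 'd \<Rightarrow> int ^ 'd \<Rightarrow> real"
    and \<Lambda> :: "(int ^ 'd) set" +
  assumes action: "mp_action P \<tau>"
    and ergodic: "ergodic_action P \<tau>"
    and p_measurable: "\<And>x y. (\<lambda>\<omega>. p \<omega> x y) \<in> borel_measurable P"
    and p_nonneg: "\<And>\<omega> x y. \<omega> \<in> space P \<Longrightarrow> 0 \<le> p \<omega> x y"
    and row_sum: "\<And>\<omega> x. \<omega> \<in> space P \<Longrightarrow> ((\<lambda>y. p \<omega> x y) has_sum 1) UNIV"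
    and column_sum: "\<And>\<omega> y. \<omega> \<in> space P \<Longrightarrow> ((\<lambda>x. p \<omega> x y) has_sum 1) UNIV"
    and finite_range: "finite \<Lambda>"
      "\<And>\<omega> x y. \<omega> \<in> space P \<Longrightarrow> y - x \<notin> \<Lambda> \<Longrightarrow> p \<omega> x y = 0"
    and zero_drift: "\<And>\<omega> x. \<omega> \<in> space P \<Longrightarrow>
      ((\<lambda>y. p \<omega> x y *\<^sub>R real_vec (y - x)) has_sum 0) UNIV"
    and covariance: "\<And>\<omega> x y z. \<omega> \<in> space P \<Longrightarrow> p (\<tau> z \<omega>) x y = p \<omega> (x + z) (y + z)"
    and irreducible: "AE \<omega> in P. \<forall>y. \<exists>n\<ge>1. 0 < n_step (p \<omega>) n 0 y"

section \<open>The point of view of the particle\<close>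

text \<open>Throughout, \<open>d 1, \<dots>, d N\<close> is an enumeration of the range \<open>\<Lambda>\<close>.\<close>

primrec cut :: "('w \<Rightarrow> int ^ 'd \<Rightarrow> int ^ 'd \<Rightarrow> real) \<Rightarrow> (nat \<Rightarrow> int ^ 'd) \<Rightarrow> 'w \<Rightarrow> nat \<Rightarrow> real" where
  "cut p d \<omega> 0 = 0"
| "cut p d \<omega> (Suc i) = cut p d \<omega> i + p \<omega> 0 (d (Suc i))"

definition branch ::
    "('w \<Rightarrow> int ^ 'd \<Rightarrow> int ^ 'd \<Rightarrow> real) \<Rightarrow> (nat \<Rightarrow> int ^ 'd) \<Rightarrow> nat \<Rightarrow> real \<times> 'w \<Rightarrow> nat" where
  "branch p d N = (\<lambda>(s, \<omega>). THE i. i \<in> {1..N} \<and> s \<in> {cut p d \<omega> (i - 1)..<cut p d \<omega> i})"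

definition displacement ::
    "('w \<Rightarrow> int ^ 'd \<Rightarrow> int ^ 'd \<Rightarrow> real) \<Rightarrow> (nat \<Rightarrow> int ^ 'd) \<Rightarrow> nat \<Rightarrow> real \<times> 'w \<Rightarrow> int ^ 'd" where
  "displacement p d N m = d (branch p d N m)"

definition internal_dynamics ::
    "('w \<Rightarrow> int ^ 'd \<Rightarrow> int ^ 'd \<Rightarrow> real) \<Rightarrow> (nat \<Rightarrow> int ^ 'd) \<Rightarrow> nat \<Rightarrow> real \<times> 'w \<Rightarrow> real" where
  "internal_dynamics p d N = (\<lambda>(s, \<omega>).
     let i = branch p d N (s, \<omega>) in inverse (p \<omega> 0 (d i)) * (s - cut p d \<omega> (i - 1)))"

definition pvp_map ::
    "(int ^ 'd \<Rightarrow> 'w \<Rightarrow> 'w) \<Rightarrow> ('w \<Rightarrow> int ^ 'd \<Rightarrow> int ^ 'd \<Rightarrow> real) \<Rightarrow> (nat \<Rightarrow> int ^ 'd) \<Rightarrow> nat \<Rightarrow>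
     real \<times> 'w \<Rightarrow> real \<times> 'w" where
  "pvp_map \<tau> p d N = (\<lambda>(s, \<omega>).
     (internal_dynamics p d N (s, \<omega>), \<tau> (displacement p d N (s, \<omega>)) \<omega>))"

definition pvp_measure :: "'w measure \<Rightarrow> (real \<times> 'w) measure" where
  "pvp_measure P = restrict_space lborel {0..<1} \<Otimes>\<^sub>M P"

definition walk ::
    "(int ^ 'd \<Rightarrow> 'w \<Rightarrow> 'w) \<Rightarrow> ('w \<Rightarrow> int ^ 'd \<Rightarrow> int ^ 'd \<Rightarrow> real) \<Rightarrow> (nat \<Rightarrow> int ^ 'd) \<Rightarrow> nat \<Rightarrow>
     nat \<Rightarrow> real \<times> 'w \<Rightarrow> int ^ 'd" where
  "walk \<tau> p d N n m = (\<Sum>k<n. displacement p d N ((pvp_map \<tau> p d N ^^ k) m))"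

section \<open>Gaussian laws and convergence in distribution on \<open>\<real>\<^sup>d\<close>\<close>

text \<open>The second parameter is the standard deviation; the law is a point mass if it is zero.\<close>

definition normal_law :: "real \<Rightarrow> real \<Rightarrow> real measure" where
  "normal_law m \<sigma> =
     (if \<sigma> = 0 then return borel m else density lborel (\<lambda>x. ennreal (normal_density m \<sigma> x)))"

text \<open>A Borel probability measure is Gaussian if every linear functional is normally distributed
  (possibly with zero variance).\<close>

definition gaussian_law :: "(real ^ 'd) measure \<Rightarrow> bool" where
  "gaussian_law G \<longleftrightarrow> prob_space G \<and> sets G = sets borel \<and>
     (\<forall>u. \<exists>m \<sigma>. 0 \<le> \<sigma> \<and> distr G borel (\<lambda>x. u \<bullet> x) = normal_law m \<sigma>)"

definition mean_vector :: "(real ^ 'd) measure \<Rightarrow> real ^ 'd" where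
  "mean_vector G = (\<chi> \<alpha>. \<integral>x. x $ \<alpha> \<partial>G)"

definition covariance_matrix :: "(real ^ 'd) measure \<Rightarrow> real ^ 'd ^ 'd" where
  "covariance_matrix G =
     (\<chi> \<alpha> \<beta>. \<integral>x. (x $ \<alpha> - mean_vector G $ \<alpha>) * (x $ \<beta> - mean_vector G $ \<beta>) \<partial>G)"

text \<open>Weak convergence of laws; the library's \<^const>\<open>weak_conv_m\<close> only covers the real line.\<close>

definition converges_weakly ::
    "(nat \<Rightarrow> 'v::topological_space measure) \<Rightarrow> 'v measure \<Rightarrow> bool" where
  "converges_weakly \<nu> G \<longleftrightarrow>
     (\<forall>f :: 'v \<Rightarrow> real. continuous_on UNIV f \<and> bounded (range f) \<longrightarrow>
        (\<lambda>n. \<integral>x. f x \<partial>\<nu> n) \<longlonglongrightarrow> (\<integral>x. f x \<partial>G))"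

end

theory Submission
  imports Defs
begin

text \<open>
  Let \<open>\<omega>\<^sub>k\<close> be the environment seen from the particle after \<open>k\<close> steps and fix a vector \<open>u\<close>. Since the
  local drift vanishes, \<open>u \<bullet> X\<^sub>n\<close> is a sum of bounded martingale differences whose conditional variances
  \<open>v(\<omega>\<^sub>k)\<close>, with \<open>v(\<omega>) = (\<Sum>i. q\<^sub>i(\<omega>) (u \<bullet> d\<^sub>i)\<^sup>2)\<close>, depend on the environment only. Hence the theorem is a
  martingale central limit theorem once these variances are known to average out, and two estimates
  have to be combined.

  \<^bold>\<open>Compensation.\<close> Put \<open>Q\<^sub>n = v(\<omega>\<^sub>0) + \<dots> + v(\<omega>\<^sub>n\<^sub>-\<^sub>1)\<close>. One step multiplies
  \<open>exp (\<i> \<theta> (u \<bullet> X\<^sub>n) + \<theta>\<^sup>2 Q\<^sub>n / 2)\<close> by a factor whose conditional mean is \<open>1 + O(\<theta>\<^sup>3)\<close>, so for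
  \<open>\<theta> = n\<^sup>-\<^sup>1\<^sup>/\<^sup>2\<close> its expectation tends to \<open>1\<close>, uniformly in the initial environment
  (\<open>compensated_quenched\<close>). The estimate is an induction on \<open>n\<close> through the decomposition at the first step
  (\<open>first_step_quenched\<close>).

  \<^bold>\<open>Law of large numbers.\<close> The factor \<open>exp (Q\<^sub>n / (2 n))\<close> can be replaced by a constant because \<open>Q\<^sub>n / n\<close>
  converges in mean square to \<open>\<integral> v d\<Pi>\<close> (\<open>L2_ergodic_theorem\<close>). Column sums equal to \<open>1\<close> and covariance make
  \<open>\<Pi>\<close> stationary for the environment chain (\<open>integral_markov\<close>). To a centred bounded \<open>h\<close> one may apply the
  transition operator, or take midpoints of functions so obtained, without changing the asymptotics of
  the averages along the chain, and functions of arbitrarily small norm arise in this way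
  (\<open>hull_small_norm\<close>): a sequence of such functions that minimises the norm converges to a function of zero
  energy, which is constant along almost every walk. By irreducibility that function is invariant under all
  shifts, and by ergodicity it is constant, so it is zero.

  The two estimates give the pointwise limit of the characteristic functions of \<open>X\<^sub>n / \<surd>n\<close>. The limit is
  Gaussian with covariance \<open>C = (\<Sum>i. \<integral> q\<^sub>i d\<Pi> \<sqdot> d\<^sub>i d\<^sub>i\<^sup>T)\<close>, and this expression also exhibits the limit law,
  degenerate or not: it is the law of \<open>(\<Sum>i. \<surd>(\<integral> q\<^sub>i d\<Pi>) Z\<^sub>i d\<^sub>i)\<close> for independent standard normal \<open>Z\<^sub>i\<close>
  (\<open>gaussian_law_exists\<close>). Finally the second moments of \<open>X\<^sub>n / \<surd>n\<close> are bounded, so convergence of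
  characteristic functions implies weak convergence (\<open>converges_weaklyI_char\<close>).
\<close>

section \<open>Weak convergence from characteristic functions\<close>

text \<open>The functions whose integrals are controlled by the characteristic function: the linear span of
  \<open>cos (u \<bullet> x)\<close> and \<open>sin (u \<bullet> x)\<close> over all frequencies \<open>u\<close>.\<close>
inductive trig_polynomial :: "('v::euclidean_space \<Rightarrow> real) \<Rightarrow> bool" where
  cos: "trig_polynomial (\<lambda>x. cos (u \<bullet> x))"
| sin: "trig_polynomial (\<lambda>x. sin (u \<bullet> x))"
| scale: "trig_polynomial f \<Longrightarrow> trig_polynomial (\<lambda>x. c * f x)"
| add: "trig_polynomial f \<Longrightarrow> trig_polynomial g \<Longrightarrow> trig_polynomial (\<lambda>x. f x + g x)"

lemma trig_polynomial_const: "trig_polynomial (\<lambda>x. c)"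
  using trig_polynomial.scale[OF trig_polynomial.cos[of 0], of c] by simp

lemma trig_polynomial_sum:
  "(\<And>i. i \<in> I \<Longrightarrow> trig_polynomial (f i)) \<Longrightarrow> trig_polynomial (\<lambda>x. \<Sum>i\<in>I. f i x)"
proof (induction I rule: infinite_finite_induct)
  case (insert i I)
  then show ?case using trig_polynomial.add[of "f i" "\<lambda>x. \<Sum>i\<in>I. f i x"] by auto
qed (auto simp: trig_polynomial_const)

lemma trig_polynomial_mult_cos:
  assumes "trig_polynomial f" shows "trig_polynomial (\<lambda>x. f x * cos (v \<bullet> x))"
  using assms
proof induction
  case (cos u)
  have "trig_polynomial (\<lambda>x. 1/2 * cos ((u - v) \<bullet> x) + 1/2 * cos ((u + v) \<bullet> x))"
    by (intro trig_polynomial.intros)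
  then show ?case by (simp add: inner_diff_left inner_add_left cos_add cos_diff field_simps)
next
  case (sin u)
  have "trig_polynomial (\<lambda>x. 1/2 * sin ((u - v) \<bullet> x) + 1/2 * sin ((u + v) \<bullet> x))"
    by (intro trig_polynomial.intros)
  then show ?case by (simp add: inner_diff_left inner_add_left sin_add sin_diff field_simps)
next
  case (scale f c)
  then show ?case using trig_polynomial.scale[of _ c] by (simp add: mult.assoc)
next
  case (add f g)
  then show ?case using trig_polynomial.add by (simp add: distrib_right)
qed

lemma trig_polynomial_mult_sin:
  assumes "trig_polynomial f" shows "trig_polynomial (\<lambda>x. f x * sin (v \<bullet> x))"
  using assms
proof induction
  case (cos u)
  have "trig_polynomial (\<lambda>x. 1/2 * sin ((u + v) \<bullet> x) + (-1/2) * sin ((u - v) \<bullet> x))"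
    by (intro trig_polynomial.intros)
  then show ?case by (simp add: inner_diff_left inner_add_left sin_add sin_diff field_simps)
next
  case (sin u)
  have "trig_polynomial (\<lambda>x. 1/2 * cos ((u - v) \<bullet> x) + (-1/2) * cos ((u + v) \<bullet> x))"
    by (intro trig_polynomial.intros)
  then show ?case by (simp add: inner_diff_left inner_add_left cos_add cos_diff field_simps)
next
  case (scale f c)
  then show ?case using trig_polynomial.scale[of _ c] by (simp add: mult.assoc)
next
  case (add f g)
  then show ?case using trig_polynomial.add by (simp add: distrib_right)
qed

text \<open>By the addition formulas, a product of waves is a combination of the waves at the sums and
  differences of the frequencies.\<close>
lemma trig_polynomial_mult:
  assumes "trig_polynomial f" "trig_polynomial g" shows "trig_polynomial (\<lambda>x. f x * g x)"
  using assms(2)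
proof induction
  case (scale g c)
  then show ?case using trig_polynomial.scale[of _ c] by (simp add: mult.left_commute)
next
  case (add g h)
  then show ?case using trig_polynomial.add by (simp add: distrib_left)
qed (use assms(1) in \<open>auto intro: trig_polynomial_mult_cos trig_polynomial_mult_sin\<close>)

lemma trig_polynomial_compose_sin:
  fixes g :: "real ^ 'd \<Rightarrow> real"
  assumes "real_polynomial_function g"
  shows "trig_polynomial (\<lambda>x::real^'d. g (\<chi> j. sin (x $ j / L)))"
  using assms
proof induction
  case (linear f)
  interpret f: bounded_linear f by fact
  have eq: "f y = (\<Sum>j\<in>UNIV. f (axis j 1) * (y $ j))" for y
  proof -
    have "f y = f (\<Sum>j\<in>UNIV. y $ j *\<^sub>R axis j 1)"
      by (metis basis_expansion scalar_mult_eq_scaleR)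
    also have "\<dots> = (\<Sum>j\<in>UNIV. f (axis j 1) * (y $ j))"
      by (simp add: f.sum f.scaleR mult.commute)
    finally show ?thesis .
  qed
  have "trig_polynomial (\<lambda>x::real^'d. \<Sum>j\<in>UNIV. f (axis j 1) * sin (((1 / L) *\<^sub>R axis j 1) \<bullet> x))"
    by (intro trig_polynomial_sum trig_polynomial.intros)
  then show ?case by (subst eq) (simp add: inner_axis')
next
  case (const c)
  then show ?case by (rule trig_polynomial_const)
next
  case (add f g)
  then show ?case by (auto intro: trig_polynomial.add)
next
  case (mult f g)
  then show ?case by (auto intro: trig_polynomial_mult)
qed

text \<open>The substitution \<open>y\<^sub>j = sin (x\<^sub>j / L)\<close> maps \<open>\<real>\<^sup>d\<close> into a cube and is inverted by \<open>L arcsin y\<^sub>j\<close> as long as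
  \<open>norm x \<le> L\<close>. A polynomial in \<open>y\<close> that is uniformly close on the cube to the transported function is
  therefore, read as a function of \<open>x\<close>, a trigonometric polynomial which is close to \<open>f\<close> on the ball of
  radius \<open>L\<close> and never exceeds the bound \<open>B\<close> by more than \<open>e\<close>; the quadratic term pays for the
  complement of the ball.\<close>
lemma trig_polynomial_approx:
  fixes f :: "real ^ 'd \<Rightarrow> real"
  assumes f: "continuous_on UNIV f" and B: "\<And>x. \<bar>f x\<bar> \<le> B" and e: "0 < e" and L: "0 < L"
  obtains q where "trig_polynomial q" "\<And>x. \<bar>f x - q x\<bar> \<le> e + (2 * B + e) * (norm x)\<^sup>2 / L\<^sup>2"
proof -
  define F where "F y = f (\<chi> j. L * arcsin (y $ j))" for y
  (* arcsin is continuous on the closed interval, so F is continuous up to the boundary of the cube. *)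
  have "compact (cbox (\<chi> j. -1) (\<chi> j. 1) :: (real^'d) set)" by (rule compact_cbox)
  moreover have "continuous_on (cbox (\<chi> j. -1) (\<chi> j. 1)) F"
    unfolding F_def
  proof (rule continuous_on_compose2[OF f])
    show "continuous_on (cbox (\<chi> j. -1) (\<chi> j. 1)) (\<lambda>y::real^'d. \<chi> j. L * arcsin (y $ j))"
      by (intro continuous_on_vec_lambda continuous_intros continuous_on_arcsin)
         (auto simp: mem_box_cart)
  qed auto
  ultimately obtain g where g: "real_polynomial_function g"
    and gF: "\<And>y. y \<in> cbox (\<chi> j. -1) (\<chi> j. 1) \<Longrightarrow> \<bar>F y - g y\<bar> < e"
    using e by (rule Stone_Weierstrass_real_polynomial_function) blast
  define q where "q x = g (\<chi> j. sin (x $ j / L))" for x :: "real^'d"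
  have "trig_polynomial q"
    unfolding q_def by (rule trig_polynomial_compose_sin[OF g])
  moreover have "\<bar>f x - q x\<bar> \<le> e + (2 * B + e) * (norm x)\<^sup>2 / L\<^sup>2" for x
  proof -
    define y :: "real^'d" where "y = (\<chi> j. sin (x $ j / L))"
    have Fq: "\<bar>F y - q x\<bar> < e"
      unfolding q_def y_def[symmetric] by (rule gF) (auto simp: y_def mem_box_cart)
    have B0: "0 \<le> B" using B[of 0] by linarith
    have t0: "0 \<le> (2 * B + e) * (norm x)\<^sup>2 / L\<^sup>2" using B0 e by simp
    (* Inside the ball the angles x $ j / L lie in [-1, 1], hence between -pi/2 and pi/2. *)
    show ?thesis
    proof (cases "norm x \<le> L")
      case True
      have "L * arcsin (y $ j) = x $ j" for j
      proof -
        have "\<bar>x $ j\<bar> \<le> L" using component_le_norm_cart[of x j] True by linarith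
        then have "\<bar>x $ j / L\<bar> \<le> 1" using L by (simp add: field_simps)
        then have "- (pi / 2) \<le> x $ j / L" "x $ j / L \<le> pi / 2"
          using pi_ge_two by linarith+
        then show ?thesis using L by (simp add: y_def arcsin_sin)
      qed
      then have "F y = f x" by (simp add: F_def)
      then show ?thesis using Fq t0 by linarith
    next
      case False
      then have "1 \<le> (norm x / L)\<^sup>2" using L by (simp add: one_le_power)
      then have "2 * B + e \<le> (2 * B + e) * (norm x)\<^sup>2 / L\<^sup>2"
        using mult_left_mono[of 1 "(norm x / L)\<^sup>2" "2*B+e"] B0 e by (simp add: power_divide)
      moreover have "\<bar>f x - q x\<bar> \<le> 2 * B + e"
        using B[of x] B[of "\<chi> j. L * arcsin (y $ j)"] Fq unfolding F_def by linarith
      ultimately show ?thesis using e by linarith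
    qed
  qed
  ultimately show thesis using that by blast
qed

lemma trig_polynomial_integral_tendsto:
  fixes \<nu> :: "nat \<Rightarrow> 'v::euclidean_space measure"
  assumes prob: "\<And>n. prob_space (\<nu> n)" "prob_space G"
    and sets: "\<And>n. sets (\<nu> n) = sets borel" "sets G = sets borel"
    and char: "\<And>u. (\<lambda>n. \<integral>x. iexp (u \<bullet> x) \<partial>\<nu> n) \<longlonglongrightarrow> (\<integral>x. iexp (u \<bullet> x) \<partial>G)"
    and q: "trig_polynomial q"
  shows "(\<forall>n. integrable (\<nu> n) q) \<and> integrable G q \<and> (\<lambda>n. \<integral>x. q x \<partial>\<nu> n) \<longlonglongrightarrow> (\<integral>x. q x \<partial>G)"
proof -
  have int: "integrable M (\<lambda>x. iexp (u \<bullet> x))" if "prob_space M" "sets M = sets borel"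
    for M and u :: 'v
  proof -
    interpret prob_space M by fact
    have [measurable_cong]: "sets M = sets borel" by fact
    show ?thesis by (rule integrable_const_bound[where B=1]) auto
  qed
  have cosint: "integrable M (\<lambda>x. cos (u \<bullet> x))" "integrable M (\<lambda>x. sin (u \<bullet> x))"
      "(\<integral>x. cos (u \<bullet> x) \<partial>M) = Re (\<integral>x. iexp (u \<bullet> x) \<partial>M)"
      "(\<integral>x. sin (u \<bullet> x) \<partial>M) = Im (\<integral>x. iexp (u \<bullet> x) \<partial>M)"
    if M: "prob_space M" "sets M = sets borel" for M and u :: 'v
    using integrable_Re[OF int[OF M, of u]] integrable_Im[OF int[OF M, of u]]
      integral_Re[OF int[OF M, of u]] integral_Im[OF int[OF M, of u]]
    by (simp_all flip: exp_Euler add: cis_conv_exp[symmetric])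
  show ?thesis using q
  proof induction
    case (cos u)
    show ?case using cosint[OF prob(1) sets(1)] cosint[OF prob(2) sets(2)] tendsto_Re[OF char[of u]]
      by simp
  next
    case (sin u)
    show ?case using cosint[OF prob(1) sets(1)] cosint[OF prob(2) sets(2)] tendsto_Im[OF char[of u]]
      by simp
  next
    case (scale f c)
    then show ?case by (auto intro: tendsto_intros)
  next
    case (add f g)
    then show ?case by (auto intro: tendsto_intros)
  qed
qed

text \<open>The bounded second moments supply the tightness: integrated against laws with second moment at most
  \<open>K\<close>, the error in \<open>trig_polynomial_approx\<close> is small, uniformly in the law, once \<open>L\<close> is large.\<close>
lemma converges_weaklyI_char:
  fixes \<nu> :: "nat \<Rightarrow> (real ^ 'd) measure"
  assumes prob: "\<And>n. prob_space (\<nu> n)" "prob_space G"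
    and sets: "\<And>n. sets (\<nu> n) = sets borel" "sets G = sets borel"
    and char: "\<And>u. (\<lambda>n. \<integral>x. iexp (u \<bullet> x) \<partial>\<nu> n) \<longlonglongrightarrow> (\<integral>x. iexp (u \<bullet> x) \<partial>G)"
    and mom: "\<And>n. integrable (\<nu> n) (\<lambda>x. (norm x)\<^sup>2)" "integrable G (\<lambda>x. (norm x)\<^sup>2)"
      "\<And>n. (\<integral>x. (norm x)\<^sup>2 \<partial>\<nu> n) \<le> K" "(\<integral>x. (norm x)\<^sup>2 \<partial>G) \<le> K"
  shows "converges_weakly \<nu> G"
  unfolding converges_weakly_def
proof (intro allI impI, elim conjE)
  fix f :: "real ^ 'd \<Rightarrow> real"
  assume f: "continuous_on UNIV f" and "bounded (range f)"
  then obtain B where B: "\<And>x. \<bar>f x\<bar> \<le> B" by (auto simp: bounded_iff)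
  have fint: "integrable M f" if "prob_space M" and s: "sets M = sets borel" for M
  proof -
    interpret prob_space M by fact
    have "f \<in> borel_measurable M"
      using borel_measurable_continuous_onI[OF f] s measurable_cong_sets by blast
    then show ?thesis using B by (intro integrable_const_bound[where B=B]) auto
  qed
  have B0: "0 \<le> B" using B[of 0] by linarith
  have K0: "0 \<le> K" by (rule order_trans[OF _ mom(4)]) simp
  show "(\<lambda>n. \<integral>x. f x \<partial>\<nu> n) \<longlonglongrightarrow> (\<integral>x. f x \<partial>G)"
  proof (rule LIMSEQ_I)
    fix r :: real assume r: "0 < r"
    (* L is chosen so that the quadratic error term integrates to at most e; the laws \<nu> n and G cost 2 e
       each, and the trigonometric polynomial costs another e. *)
    define e where "e = r / 6"
    define L where "L = sqrt ((2 * B + e) * (K + 1) / e)"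
    have e: "0 < e" using r by (simp add: e_def)
    have L2: "L\<^sup>2 = (2 * B + e) * (K + 1) / e" using B0 K0 e by (simp add: L_def)
    have L: "0 < L" using B0 K0 e by (simp add: L_def)
    obtain q where q: "trig_polynomial q"
      and qf: "\<And>x. \<bar>f x - q x\<bar> \<le> e + (2 * B + e) * (norm x)\<^sup>2 / L\<^sup>2"
      using trig_polynomial_approx[OF f B e L] by blast
    have qint: "\<And>n. integrable (\<nu> n) q" "integrable G q"
      and qlim: "(\<lambda>n. \<integral>x. q x \<partial>\<nu> n) \<longlonglongrightarrow> (\<integral>x. q x \<partial>G)"
      using trig_polynomial_integral_tendsto[OF prob sets char q] by auto
    have close: "\<bar>(\<integral>x. f x \<partial>M) - (\<integral>x. q x \<partial>M)\<bar> \<le> 2 * e"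
      if M: "prob_space M" "sets M = sets borel" and qM: "integrable M q"
        and n: "integrable M (\<lambda>x. (norm x)\<^sup>2)" "(\<integral>x. (norm x)\<^sup>2 \<partial>M) \<le> K" for M
    proof -
      interpret prob_space M by fact
      have "\<bar>(\<integral>x. f x \<partial>M) - (\<integral>x. q x \<partial>M)\<bar> = \<bar>\<integral>x. f x - q x \<partial>M\<bar>"
        using fint[OF M] qM by simp
      also have "\<dots> \<le> (\<integral>x. \<bar>f x - q x\<bar> \<partial>M)" by (rule integral_abs_bound)
      also have "\<dots> \<le> (\<integral>x. e + (2 * B + e) / L\<^sup>2 * (norm x)\<^sup>2 \<partial>M)"
        using fint[OF M] qM n qf by (intro integral_mono) auto
      also have "\<dots> = e + (2 * B + e) / L\<^sup>2 * (\<integral>x. (norm x)\<^sup>2 \<partial>M)"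
        using n by (simp add: prob_space)
      also have "\<dots> \<le> e + (2 * B + e) / L\<^sup>2 * (K + 1)"
        using n B0 e by (intro add_left_mono mult_left_mono) auto
      also have "\<dots> = 2 * e"
      proof -
        have "2 * B + e \<noteq> 0" "K + 1 \<noteq> 0" using B0 K0 e by linarith+
        then show ?thesis unfolding L2 by (simp add: divide_simps)
      qed
      finally show ?thesis .
    qed
    obtain n0 where n0: "\<And>n. n \<ge> n0 \<Longrightarrow> \<bar>(\<integral>x. q x \<partial>\<nu> n) - (\<integral>x. q x \<partial>G)\<bar> < e"
      using LIMSEQ_D[OF qlim e] by auto
    have "norm ((\<integral>x. f x \<partial>\<nu> n) - (\<integral>x. f x \<partial>G)) < r" if "n \<ge> n0" for n
      using n0[OF that] close[OF prob(1) sets(1) qint(1) mom(1) mom(3), of n]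
        close[OF prob(2) sets(2) qint(2) mom(2) mom(4)] r
      unfolding real_norm_def e_def by linarith
    then show "\<exists>n0. \<forall>n\<ge>n0. norm ((\<integral>x. f x \<partial>\<nu> n) - (\<integral>x. f x \<partial>G)) < r" by blast
  qed
qed

section \<open>Gaussian laws with prescribed projections\<close>

lemma moment_std_normal:
  "has_bochner_integral std_normal_distribution (\<lambda>x. x) 0"
  "has_bochner_integral std_normal_distribution (\<lambda>x. x\<^sup>2) 1"
proof -
  have 1: "has_bochner_integral lborel (\<lambda>x. std_normal_density x * x) 0"
    using std_normal_moment_odd[of 0] by simp
  have 2: "has_bochner_integral lborel (\<lambda>x. std_normal_density x * x\<^sup>2) 1"
    using std_normal_moment_even[of 1] by (simp add: fact_numeral)
  show "has_bochner_integral std_normal_distribution (\<lambda>x. x) 0"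
    using 1 by (intro has_bochner_integral_density) auto
  show "has_bochner_integral std_normal_distribution (\<lambda>x. x\<^sup>2) 1"
    using 2 by (intro has_bochner_integral_density) auto
qed

text \<open>Writing the law as an image of the standard normal law treats zero variance together with positive
  variance.\<close>
lemma normal_law_scale:
  assumes "0 \<le> \<sigma>"
  shows "normal_law 0 \<sigma> = distr std_normal_distribution borel (\<lambda>x. \<sigma> * x)"
proof (cases "\<sigma> = 0")
  case True
  interpret prob_space std_normal_distribution by (rule prob_space_normal_density) simp
  show ?thesis using True by (simp add: normal_law_def distr_const)
next
  case False
  interpret prob_space std_normal_distribution by (rule prob_space_normal_density) simp
  have "distributed std_normal_distribution lborel (\<lambda>x. x) (\<lambda>x. ennreal (std_normal_density x))"
    by (simp add: distributed_def distr_id2)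
  then have "distributed std_normal_distribution lborel (\<lambda>x. 0 + \<sigma> * x)
      (\<lambda>x. ennreal (normal_density (0 + \<sigma> * 0) (\<bar>\<sigma>\<bar> * 1) x))"
    using False by (intro normal_density_affine) auto
  then show ?thesis
    using False assms by (simp add: normal_law_def distributed_def cong: distr_cong)
qed

lemma normal_law:
  assumes "0 \<le> \<sigma>"
  shows real_distribution_normal_law: "real_distribution (normal_law 0 \<sigma>)"
    and char_normal_law: "char (normal_law 0 \<sigma>) t = exp (- (\<sigma> * t)\<^sup>2 / 2)"
    and normal_law_moment1: "has_bochner_integral (normal_law 0 \<sigma>) (\<lambda>x. x) 0"
    and normal_law_moment2: "has_bochner_integral (normal_law 0 \<sigma>) (\<lambda>x. x\<^sup>2) (\<sigma>\<^sup>2)"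
proof -
  interpret std: real_distribution std_normal_distribution by (rule real_dist_normal_dist)
  show "real_distribution (normal_law 0 \<sigma>)"
    unfolding normal_law_scale[OF assms]
    by (intro std.real_distribution_distr) simp
  show "char (normal_law 0 \<sigma>) t = exp (- (\<sigma> * t)\<^sup>2 / 2)"
  proof -
    have "char (normal_law 0 \<sigma>) t = char std_normal_distribution (\<sigma> * t)"
      unfolding normal_law_scale[OF assms] char_def
      by (subst integral_distr) (auto simp: mult_ac)
    then show ?thesis by (simp add: char_std_normal_distribution)
  qed
  show "has_bochner_integral (normal_law 0 \<sigma>) (\<lambda>x. x) 0"
    unfolding normal_law_scale[OF assms]
    using has_bochner_integral_mult_right[where c=\<sigma>, OF moment_std_normal(1)]
    by (intro has_bochner_integral_distr) auto
  show "has_bochner_integral (normal_law 0 \<sigma>) (\<lambda>x. x\<^sup>2) (\<sigma>\<^sup>2)"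
    unfolding normal_law_scale[OF assms]
    using has_bochner_integral_mult_right[where c="\<sigma>\<^sup>2", OF moment_std_normal(2)]
    by (intro has_bochner_integral_distr) (auto simp: power_mult_distrib)
qed

text \<open>The witness is the law of \<open>(\<Sum>i. \<surd>(w\<^sub>i) z\<^sub>i a\<^sub>i)\<close> under a product of standard normal laws. Its projection on
  \<open>u\<close> is a sum of independent normal variables, which is identified by its characteristic function.\<close>
lemma gaussian_law_exists:
  fixes a :: "'i \<Rightarrow> real ^ 'd" and w :: "'i \<Rightarrow> real"
  assumes "finite I" and w: "\<And>i. i \<in> I \<Longrightarrow> 0 \<le> w i"
  obtains G where "prob_space G" "sets G = sets borel"
    "\<And>u. distr G borel (\<lambda>x. u \<bullet> x) = normal_law 0 (sqrt (\<Sum>i\<in>I. w i * (u \<bullet> a i)\<^sup>2))"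
proof -
  define M where "M = (\<Pi>\<^sub>M i\<in>I. std_normal_distribution)"
  interpret std: real_distribution std_normal_distribution by (rule real_dist_normal_dist)
  interpret pp: product_prob_space "\<lambda>_. std_normal_distribution" I ..
  interpret M: prob_space M unfolding M_def by (rule pp.prob_space_axioms)
  define Y where "Y = (\<lambda>z. \<Sum>i\<in>I. (sqrt (w i) * z i) *\<^sub>R a i)"
  have comp: "(\<lambda>z. z i) \<in> borel_measurable M" if "i \<in> I" for i
    using measurable_component_singleton[OF that, of "\<lambda>_. std_normal_distribution"]
    by (simp add: M_def)
  have Y: "Y \<in> borel_measurable M"
    unfolding Y_def using comp by (intro borel_measurable_sum borel_measurable_scaleR borel_measurable_times) auto
  define G where "G = distr M borel Y"
  show thesis
  proof (rule that[of G])
    show "prob_space G" unfolding G_def by (rule M.prob_space_distr[OF Y])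
    show "sets G = sets borel" by (simp add: G_def)
    fix u :: "real ^ 'd"
    define s where "s = (\<Sum>i\<in>I. w i * (u \<bullet> a i)\<^sup>2)"
    have s: "0 \<le> s" using w by (auto simp: s_def intro!: sum_nonneg)
    define c where "c i = sqrt (w i) * (u \<bullet> a i)" for i
    have uY: "u \<bullet> Y z = (\<Sum>i\<in>I. c i * z i)" for z
      by (simp add: Y_def c_def inner_sum_right mult_ac)
    have c2: "(c i)\<^sup>2 = w i * (u \<bullet> a i)\<^sup>2" if "i \<in> I" for i
      using w[OF that] by (simp add: c_def power_mult_distrib)
    have "distr G borel (\<lambda>x. u \<bullet> x) = distr M borel (\<lambda>z. u \<bullet> Y z)"
      unfolding G_def using Y by (subst distr_distr) (auto simp: comp_def)
    also have "\<dots> = normal_law 0 (sqrt s)"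
    proof (rule Levy_uniqueness)
      show "real_distribution (distr M borel (\<lambda>z. u \<bullet> Y z))"
        using Y by (intro M.real_distribution_distr) simp
      show "real_distribution (normal_law 0 (sqrt s))"
        using s by (intro real_distribution_normal_law) simp
      show "char (distr M borel (\<lambda>z. u \<bullet> Y z)) = char (normal_law 0 (sqrt s))"
      proof
        fix t
        have "char (distr M borel (\<lambda>z. u \<bullet> Y z)) t = (\<integral>z. iexp (t * (u \<bullet> Y z)) \<partial>M)"
          unfolding char_def using Y by (subst integral_distr) auto
        also have "\<dots> = (\<integral>z. (\<Prod>i\<in>I. iexp (t * c i * z i)) \<partial>M)"
          using \<open>finite I\<close>
          by (simp add: uY sum_distrib_left exp_sum[symmetric] mult.assoc)
        also have "\<dots> = (\<Prod>i\<in>I. \<integral>x. iexp (t * c i * x) \<partial>std_normal_distribution)"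
          unfolding M_def using \<open>finite I\<close> by (intro pp.product_integral_prod std.integrable_iexp) auto
        also have "\<dots> = (\<Prod>i\<in>I. char std_normal_distribution (t * c i))"
          by (simp add: char_def)
        also have "\<dots> = (\<Prod>i\<in>I. complex_of_real (exp (- (w i * (u \<bullet> a i)\<^sup>2 * t\<^sup>2) / 2)))"
          by (intro prod.cong)
             (auto simp: char_std_normal_distribution power_mult_distrib c2 mult_ac)
        also have "\<dots> = exp (\<Sum>i\<in>I. - (w i * (u \<bullet> a i)\<^sup>2 * t\<^sup>2) / 2)"
          using \<open>finite I\<close> by (simp add: exp_sum)
        also have "(\<Sum>i\<in>I. - (w i * (u \<bullet> a i)\<^sup>2 * t\<^sup>2) / 2) = - (s * t\<^sup>2) / 2"
          by (simp add: s_def sum_distrib_right sum_negf sum_divide_distrib)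
        also have "complex_of_real (exp (- (s * t\<^sup>2) / 2)) = char (normal_law 0 (sqrt s)) t"
          using s by (simp add: char_normal_law power_mult_distrib)
        finally show "char (distr M borel (\<lambda>z. u \<bullet> Y z)) t = char (normal_law 0 (sqrt s)) t" .
      qed
    qed
    finally show "distr G borel (\<lambda>x. u \<bullet> x) = normal_law 0 (sqrt (\<Sum>i\<in>I. w i * (u \<bullet> a i)\<^sup>2))"
      by (simp add: s_def)
  qed
qed

text \<open>A law on \<open>\<real>\<^sup>d\<close> whose projections are normal has its first two moments, and its characteristic
  function, determined by those projections; mixed second moments come from polarisation.\<close>
lemma projections_normal:
  fixes G :: "(real ^ 'd) measure"
  assumes G: "prob_space G" "sets G = sets borel"
    and proj: "\<And>u. distr G borel (\<lambda>x. u \<bullet> x) = normal_law 0 (sqrt (V u))"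
    and V: "\<And>u. 0 \<le> V u" 
  shows gaussian_law_projections: "gaussian_law G"
    and mean_vector_projections: "mean_vector G = 0"
    and covariance_matrix_projections:
      "covariance_matrix G = (\<chi> \<alpha> \<beta>. (V (axis \<alpha> 1 + axis \<beta> 1) - V (axis \<alpha> 1 - axis \<beta> 1)) / 4)"
    and integrable_norm_projections: "integrable G (\<lambda>x. (norm x)\<^sup>2)"
    and char_projections: "(\<integral>x. iexp (u \<bullet> x) \<partial>G) = exp (- V u / 2)"
proof -
  interpret prob_space G by fact
  have [measurable_cong]: "sets G = sets borel" by fact
  show "gaussian_law G"
    unfolding gaussian_law_def using G proj V by (metis real_sqrt_ge_zero)
  have m1: "has_bochner_integral G (\<lambda>x. u \<bullet> x) 0" for u
    using normal_law_moment1[of "sqrt (V u)"] V[of u] unfolding proj[of u, symmetric]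
    by (auto simp: has_bochner_integral_iff integrable_distr_eq integral_distr)
  have m2: "has_bochner_integral G (\<lambda>x. (u \<bullet> x)\<^sup>2) (V u)" for u
    using normal_law_moment2[of "sqrt (V u)"] V[of u] unfolding proj[of u, symmetric]
    by (auto simp: has_bochner_integral_iff integrable_distr_eq integral_distr)
  have "(\<integral>x. x $ \<alpha> \<partial>G) = 0" for \<alpha>
    using m1[of "axis \<alpha> 1"] by (simp add: inner_axis' has_bochner_integral_iff)
  then show mean: "mean_vector G = 0"
    by (simp add: mean_vector_def vec_eq_iff)
  have "has_bochner_integral G (\<lambda>x. x $ \<alpha> * x $ \<beta>)
      ((V (axis \<alpha> 1 + axis \<beta> 1) - V (axis \<alpha> 1 - axis \<beta> 1)) / 4)" for \<alpha> \<beta>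
  proof -
    have "has_bochner_integral G
        (\<lambda>x. (((axis \<alpha> 1 + axis \<beta> 1) \<bullet> x)\<^sup>2 - ((axis \<alpha> 1 - axis \<beta> 1) \<bullet> x)\<^sup>2) / 4)
        ((V (axis \<alpha> 1 + axis \<beta> 1) - V (axis \<alpha> 1 - axis \<beta> 1)) / 4)"
      by (intro has_bochner_integral_divide_zero has_bochner_integral_diff m2)
    moreover have "(((axis \<alpha> 1 + axis \<beta> 1) \<bullet> x)\<^sup>2 - ((axis \<alpha> 1 - axis \<beta> 1) \<bullet> x)\<^sup>2) / 4 =
        x $ \<alpha> * x $ \<beta>" for x :: "real^'d"
      by (simp add: inner_add_left inner_diff_left inner_axis' power2_eq_square algebra_simps)
    ultimately show ?thesis by simp
  qed
  then show "covariance_matrix G =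
      (\<chi> \<alpha> \<beta>. (V (axis \<alpha> 1 + axis \<beta> 1) - V (axis \<alpha> 1 - axis \<beta> 1)) / 4)"
    by (simp add: covariance_matrix_def mean vec_eq_iff has_bochner_integral_iff)
  have "integrable G (\<lambda>x. \<Sum>\<alpha>\<in>UNIV. (x $ \<alpha>)\<^sup>2)"
    using m2[of "axis _ 1"] by (intro Bochner_Integration.integrable_sum) (simp add: inner_axis' has_bochner_integral_iff)
  then show "integrable G (\<lambda>x. (norm x)\<^sup>2)"
    by (simp add: norm_vec_def L2_set_def sum_nonneg)
  have "(\<integral>x. iexp (u \<bullet> x) \<partial>G) = char (distr G borel (\<lambda>x. u \<bullet> x)) 1"
    unfolding char_def by (subst integral_distr) auto
  also have "\<dots> = exp (- V u / 2)"
    using V[of u] by (simp add: proj char_normal_law)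
  finally show "(\<integral>x. iexp (u \<bullet> x) \<partial>G) = exp (- V u / 2)" .
qed

section \<open>The environment seen from the particle\<close>

text \<open>The sum of the increments has finite expectation, so it is almost surely finite.\<close>
lemma (in prob_space) AE_convergent_summable_increments:
  fixes u :: "nat \<Rightarrow> 'a \<Rightarrow> real"
  assumes u[measurable]: "\<And>n. integrable M (u n)"
    and le: "\<And>n. (\<integral>x. \<bar>u (Suc n) x - u n x\<bar> \<partial>M) \<le> (1/2)^n"
  shows "AE x in M. convergent (\<lambda>n. u n x)"
proof -
  have [measurable]: "\<And>n. u n \<in> borel_measurable M" using u by blast
  have "(\<integral>\<^sup>+x. (\<Sum>n. ennreal \<bar>u (Suc n) x - u n x\<bar>) \<partial>M) =
      (\<Sum>n. \<integral>\<^sup>+x. ennreal \<bar>u (Suc n) x - u n x\<bar> \<partial>M)"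
    by (rule nn_integral_suminf) measurable
  also have "\<dots> = (\<Sum>n. ennreal (\<integral>x. \<bar>u (Suc n) x - u n x\<bar> \<partial>M))"
    using u by (intro suminf_cong nn_integral_eq_integral) auto
  also have "\<dots> \<le> (\<Sum>n. ennreal ((1/2)^n))"
    using le by (intro suminf_le ennreal_leI) auto
  also have "\<dots> = ennreal (\<Sum>n. (1/2)^n)"
    by (intro suminf_ennreal2 summable_geometric) auto
  also have "\<dots> < \<infinity>" by simp
  finally have "(\<integral>\<^sup>+x. (\<Sum>n. ennreal \<bar>u (Suc n) x - u n x\<bar>) \<partial>M) \<noteq> \<infinity>"
    by simp
  then have "AE x in M. (\<Sum>n. ennreal \<bar>u (Suc n) x - u n x\<bar>) \<noteq> \<infinity>"
    by (intro nn_integral_PInf_AE) measurable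
  then show ?thesis
  proof eventually_elim
    case (elim x)
    then have "summable (\<lambda>n. \<bar>u (Suc n) x - u n x\<bar>)"
      by (intro summable_suminf_not_top) auto
    then have "summable (\<lambda>n. u (Suc n) x - u n x)"
      by (rule summable_rabs_cancel)
    then have "convergent (\<lambda>n. \<Sum>k<n. u (Suc k) x - u k x)"
      by (simp add: summable_iff_convergent)
    then have "convergent (\<lambda>n. (u n x - u 0 x) + u 0 x)"
      by (intro convergent_add convergent_const) (simp add: sum_lessThan_telescope[of "\<lambda>k. u k x"])
    then show ?case by simp
  qed
qed

text \<open>If the \<open>n\<close>-step weight is positive, some path from \<open>x\<close> to \<open>y\<close> uses only steps of nonzero weight,
  and \<open>f\<close> is preserved along it.\<close>
lemma n_step_constant:
  assumes pos: "0 < n_step q n x y" and n: "1 \<le> n"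
    and f: "\<And>a b. q a b \<noteq> 0 \<Longrightarrow> f b = f a"
  shows "f y = f x"
proof -
  have "\<exists>xs. length xs = n - 1 \<and> (\<Prod>k<n. q ((x # xs @ [y]) ! k) ((x # xs @ [y]) ! Suc k)) \<noteq> 0"
  proof (rule ccontr)
    assume "\<not> ?thesis"
    then have "n_step q n x y = 0"
      unfolding n_step_def by (intro infsum_0) auto
    then show False using pos by simp
  qed
  then obtain xs where xs: "length xs = n - 1"
    "(\<Prod>k<n. q ((x # xs @ [y]) ! k) ((x # xs @ [y]) ! Suc k)) \<noteq> 0" by blast
  define l where "l = x # xs @ [y]"
  have "k \<le> n \<Longrightarrow> f (l ! k) = f x" for k
  proof (induction k)
    case 0
    then show ?case by (simp add: l_def)
  next
    case (Suc k)
    then have "q (l ! k) (l ! Suc k) \<noteq> 0" using xs(2) by (auto simp: l_def)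
    then have "f (l ! Suc k) = f (l ! k)" by (rule f)
    then show ?case using Suc by simp
  qed
  moreover have "l ! n = y" using xs(1) n by (simp add: l_def nth_append nth_Cons')
  ultimately show ?thesis by (metis order_refl)
qed

locale particle_view = random_environment P \<tau> p \<Lambda>
  for P :: "'w measure" and \<tau> :: "int ^ 'd \<Rightarrow> 'w \<Rightarrow> 'w"
    and p :: "'w \<Rightarrow> int ^ 'd \<Rightarrow> int ^ 'd \<Rightarrow> real" and \<Lambda> +
  fixes d :: "nat \<Rightarrow> int ^ 'd" and N :: nat
  assumes enum: "bij_betw d {1..N} \<Lambda>"
begin

definition q :: "nat \<Rightarrow> 'w \<Rightarrow> real" where "q i \<omega> = p \<omega> 0 (d i)"

text \<open>The transition operator of the environment seen from the particle.\<close>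
definition markov :: "('w \<Rightarrow> real) \<Rightarrow> 'w \<Rightarrow> real" where
  "markov g \<omega> = (\<Sum>i=1..N. q i \<omega> * g (\<tau> (d i) \<omega>))"

lemma tau_measurable [measurable]: "\<tau> z \<in> measurable P P"
  using action by (auto simp: mp_action_def)

lemma tau_space [simp]: "\<omega> \<in> space P \<Longrightarrow> \<tau> z \<omega> \<in> space P"
  using tau_measurable by (rule measurable_space)

lemma tau_zero: "\<omega> \<in> space P \<Longrightarrow> \<tau> 0 \<omega> = \<omega>"
  using action by (auto simp: mp_action_def)

lemma tau_tau: "\<omega> \<in> space P \<Longrightarrow> \<tau> y (\<tau> z \<omega>) = \<tau> (y + z) \<omega>"
  using action by (auto simp: mp_action_def)

lemma distr_tau: "distr P P (\<tau> z) = P"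
  using action by (auto simp: mp_action_def)

lemma integral_tau:
  fixes f :: "'w \<Rightarrow> real"
  assumes "f \<in> borel_measurable P"
  shows "(\<integral>\<omega>. f (\<tau> z \<omega>) \<partial>P) = (\<integral>\<omega>. f \<omega> \<partial>P)"
  using integral_distr[OF tau_measurable[of z] assms] by (simp add: distr_tau)

lemma AE_tau: "AE \<omega> in P. Q \<omega> \<Longrightarrow> AE \<omega> in P. \<forall>z. Q (\<tau> z \<omega>)"
  unfolding AE_all_countable
  using AE_distrD[OF tau_measurable, of Q, unfolded distr_tau] by blast

lemma q_measurable [measurable]: "q i \<in> borel_measurable P"
  using p_measurable[of 0 "d i"] by (simp add: q_def[abs_def])

lemma q_nonneg: "\<omega> \<in> space P \<Longrightarrow> 0 \<le> q i \<omega>"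
  by (simp add: q_def p_nonneg)

lemma q_tau: "\<omega> \<in> space P \<Longrightarrow> q i (\<tau> z \<omega>) = p \<omega> z (d i + z)"
  by (simp add: q_def covariance)

lemma finite_support_sum:
  fixes f :: "int ^ 'd \<Rightarrow> 'b::{t2_space, topological_comm_monoid_add}"
  assumes "(f has_sum s) UNIV" "\<And>y. y \<notin> A \<Longrightarrow> f y = 0" "finite A"
  shows "(\<Sum>y\<in>A. f y) = s"
proof -
  have "(f has_sum s) A"
    using assms(1) by (rule has_sum_cong_neutral[THEN iffD1, rotated -1]) (auto simp: assms(2))
  then show ?thesis using \<open>finite A\<close> infsumI by force
qed

lemma sum_q: assumes "\<omega> \<in> space P" shows "(\<Sum>i=1..N. q i \<omega>) = 1"
proof -
  have "(\<Sum>i=1..N. q i \<omega>) = (\<Sum>y\<in>\<Lambda>. p \<omega> 0 y)"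
    unfolding q_def by (rule sum.reindex_bij_betw[OF enum])
  also have "\<dots> = 1"
    using row_sum[OF assms, of 0] finite_range(2)[OF assms, of _ 0] finite_range(1)
    by (intro finite_support_sum) auto
  finally show ?thesis .
qed

lemma column_sum_range: assumes "\<omega> \<in> space P" shows "(\<Sum>i=1..N. p \<omega> (- d i) 0) = 1"
proof -
  have "(\<Sum>i=1..N. p \<omega> (- d i) 0) = (\<Sum>y\<in>\<Lambda>. p \<omega> (- y) 0)"
    by (rule sum.reindex_bij_betw[OF enum])
  also have "\<dots> = (\<Sum>x\<in>uminus ` \<Lambda>. p \<omega> x 0)"
    by (subst sum.reindex) (auto simp: inj_on_def)
  also have "\<dots> = 1"
  proof (rule finite_support_sum[OF column_sum[OF assms]])
    fix x :: "int ^ 'd" assume "x \<notin> uminus ` \<Lambda>"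
    then have "- x \<notin> \<Lambda>" by force
    then show "p \<omega> x 0 = 0" by (intro finite_range(2)[OF assms]) simp
  qed (use finite_range(1) in auto)
  finally show ?thesis .
qed

lemma sum_q_drift: assumes "\<omega> \<in> space P" shows "(\<Sum>i=1..N. q i \<omega> *\<^sub>R real_vec (d i)) = 0"
proof -
  have "(\<Sum>i=1..N. q i \<omega> *\<^sub>R real_vec (d i)) = (\<Sum>y\<in>\<Lambda>. p \<omega> 0 y *\<^sub>R real_vec y)"
    unfolding q_def by (rule sum.reindex_bij_betw[OF enum])
  also have "\<dots> = 0"
    using zero_drift[OF assms, of 0] finite_range(2)[OF assms, of _ 0] finite_range(1)
    by (intro finite_support_sum) auto
  finally show ?thesis .
qed

lemma q_le_1: assumes "\<omega> \<in> space P" "i \<in> {1..N}" shows "q i \<omega> \<le> 1"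
  using member_le_sum[of i "{1..N}" "\<lambda>i. q i \<omega>"] assms q_nonneg sum_q by auto

lemma q_average_le:
  assumes "\<omega> \<in> space P" "\<And>i. i \<in> {1..N} \<Longrightarrow> x i \<le> B"
  shows "(\<Sum>i=1..N. q i \<omega> * x i) \<le> B"
proof -
  have "(\<Sum>i=1..N. q i \<omega> * x i) \<le> (\<Sum>i=1..N. q i \<omega> * B)"
    using assms q_nonneg by (intro sum_mono mult_left_mono) auto
  also have "\<dots> = B" using sum_q[OF assms(1)] by (simp flip: sum_distrib_right)
  finally show ?thesis .
qed

lemma q_average_abs_le:
  assumes "\<omega> \<in> space P" "\<And>i. i \<in> {1..N} \<Longrightarrow> \<bar>x i\<bar> \<le> B"
  shows "\<bar>\<Sum>i=1..N. q i \<omega> * x i\<bar> \<le> B"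
  using q_average_le[OF assms(1), of x B] q_average_le[OF assms(1), of "\<lambda>i. - x i" B] assms(2)
  by (force simp: sum_negf)

lemma markov_measurable [measurable]:
  assumes [measurable]: "g \<in> borel_measurable P" shows "markov g \<in> borel_measurable P"
  unfolding markov_def[abs_def] by measurable

lemma markov_bounded:
  assumes "\<And>\<omega>. \<omega> \<in> space P \<Longrightarrow> \<bar>g \<omega>\<bar> \<le> B" "\<omega> \<in> space P"
  shows "\<bar>markov g \<omega>\<bar> \<le> B"
  unfolding markov_def using assms by (intro q_average_abs_le) auto

lemma integrable_bounded:
  fixes g :: "'w \<Rightarrow> real"
  assumes "g \<in> borel_measurable P" "\<And>\<omega>. \<omega> \<in> space P \<Longrightarrow> \<bar>g \<omega>\<bar> \<le> B"
  shows "integrable P g"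
  using assms by (intro integrable_const_bound[where B=B]) auto

text \<open>The law of the environment is stationary: covariance turns the probability \<open>q\<^sub>i\<close> of leaving \<open>0\<close> along
  \<open>d\<^sub>i\<close> into the probability of arriving at \<open>0\<close> from \<open>- d\<^sub>i\<close> in the shifted environment, the shift preserves
  the law, and the arrival probabilities sum to \<open>1\<close> because the matrix is bistochastic.\<close>
lemma integral_markov:
  fixes g :: "'w \<Rightarrow> real"
  assumes g[measurable]: "g \<in> borel_measurable P" and B: "\<And>\<omega>. \<omega> \<in> space P \<Longrightarrow> \<bar>g \<omega>\<bar> \<le> B"
  shows "(\<integral>\<omega>. markov g \<omega> \<partial>P) = (\<integral>\<omega>. g \<omega> \<partial>P)"
proof -
  have [measurable]: "(\<lambda>\<omega>. p \<omega> (- d i) 0) \<in> borel_measurable P" for i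
    by (rule p_measurable)
  have q_eq: "q i \<omega> = p (\<tau> (d i) \<omega>) (- d i) 0" if "\<omega> \<in> space P" for i \<omega>
    using that by (simp add: q_def covariance)
  have bound: "\<bar>q i \<omega> * g (\<tau> (d i) \<omega>)\<bar> \<le> 1 * B" "\<bar>p \<omega> (- d i) 0 * g \<omega>\<bar> \<le> 1 * B"
    if "\<omega> \<in> space P" "i \<in> {1..N}" for i \<omega>
  proof -
    have "p \<omega> (- d i) 0 \<le> 1"
      using member_le_sum[of i "{1..N}" "\<lambda>i. p \<omega> (- d i) 0"] that p_nonneg column_sum_range by auto
    then show "\<bar>p \<omega> (- d i) 0 * g \<omega>\<bar> \<le> 1 * B"
      unfolding abs_mult using that B p_nonneg by (intro mult_mono) auto
    show "\<bar>q i \<omega> * g (\<tau> (d i) \<omega>)\<bar> \<le> 1 * B"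
      unfolding abs_mult using that B q_nonneg q_le_1 by (intro mult_mono) auto
  qed
  have "(\<integral>\<omega>. markov g \<omega> \<partial>P) = (\<Sum>i=1..N. \<integral>\<omega>. q i \<omega> * g (\<tau> (d i) \<omega>) \<partial>P)"
    unfolding markov_def using bound(1)
    by (intro Bochner_Integration.integral_sum integrable_bounded[where B="1 * B"]) auto
  also have "\<dots> = (\<Sum>i=1..N. \<integral>\<omega>. p \<omega> (- d i) 0 * g \<omega> \<partial>P)"
  proof (rule sum.cong[OF refl])
    fix i assume "i \<in> {1..N}"
    have "(\<integral>\<omega>. q i \<omega> * g (\<tau> (d i) \<omega>) \<partial>P) =
        (\<integral>\<omega>. p (\<tau> (d i) \<omega>) (- d i) 0 * g (\<tau> (d i) \<omega>) \<partial>P)"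
      by (intro Bochner_Integration.integral_cong) (auto simp: q_eq)
    also have "\<dots> = (\<integral>\<omega>. p \<omega> (- d i) 0 * g \<omega> \<partial>P)"
      by (rule integral_tau[of "\<lambda>\<omega>. p \<omega> (- d i) 0 * g \<omega>"]) measurable
    finally show "(\<integral>\<omega>. q i \<omega> * g (\<tau> (d i) \<omega>) \<partial>P) = (\<integral>\<omega>. p \<omega> (- d i) 0 * g \<omega> \<partial>P)" .
  qed
  also have "\<dots> = (\<integral>\<omega>. (\<Sum>i=1..N. p \<omega> (- d i) 0 * g \<omega>) \<partial>P)"
    using bound(2)
    by (intro Bochner_Integration.integral_sum[symmetric] integrable_bounded[where B="1 * B"]) auto
  also have "\<dots> = (\<integral>\<omega>. g \<omega> \<partial>P)"
    by (intro Bochner_Integration.integral_cong) (auto simp: column_sum_range simp flip: sum_distrib_right simp del: One_nat_def)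
  finally show ?thesis .
qed

text \<open>Jensen's inequality for the transition probabilities, followed by stationarity.\<close>
lemma markov_square_le:
  fixes g :: "'w \<Rightarrow> real"
  assumes g[measurable]: "g \<in> borel_measurable P" and B: "\<And>\<omega>. \<omega> \<in> space P \<Longrightarrow> \<bar>g \<omega>\<bar> \<le> B"
  shows "(\<integral>\<omega>. (markov g \<omega>)\<^sup>2 \<partial>P) \<le> (\<integral>\<omega>. (g \<omega>)\<^sup>2 \<partial>P)"
proof -
  have g2: "\<bar>(g \<omega>)\<^sup>2\<bar> \<le> B\<^sup>2" if "\<omega> \<in> space P" for \<omega>
    using power_mono[OF B[OF that] abs_ge_zero, of 2] by simp
  have m2: "\<bar>(markov g \<omega>)\<^sup>2\<bar> \<le> B\<^sup>2" if "\<omega> \<in> space P" for \<omega>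
    using power_mono[OF markov_bounded[where g=g, OF B that] abs_ge_zero, where n=2] by simp
  have "(\<integral>\<omega>. (markov g \<omega>)\<^sup>2 \<partial>P) \<le> (\<integral>\<omega>. markov (\<lambda>\<omega>. (g \<omega>)\<^sup>2) \<omega> \<partial>P)"
  proof (intro integral_mono)
    show "integrable P (\<lambda>\<omega>. (markov g \<omega>)\<^sup>2)"
      using m2 by (intro integrable_bounded[where B="B\<^sup>2"]) auto
    show "integrable P (markov (\<lambda>\<omega>. (g \<omega>)\<^sup>2))"
      using markov_bounded[where g="\<lambda>\<omega>. (g \<omega>)\<^sup>2", OF g2] by (intro integrable_bounded[where B="B\<^sup>2"]) auto
    fix \<omega> assume \<omega>: "\<omega> \<in> space P"
    define m where "m = markov g \<omega>"
    have "0 \<le> (\<Sum>i=1..N. q i \<omega> * (g (\<tau> (d i) \<omega>) - m)\<^sup>2)"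
      using q_nonneg[OF \<omega>] by (intro sum_nonneg) auto
    also have "\<dots> = (\<Sum>i=1..N. q i \<omega> * (g (\<tau> (d i) \<omega>))\<^sup>2) -
        2 * m * (\<Sum>i=1..N. q i \<omega> * g (\<tau> (d i) \<omega>)) + m\<^sup>2 * (\<Sum>i=1..N. q i \<omega>)"
      by (simp add: power2_eq_square algebra_simps sum.distrib sum_subtractf sum_distrib_left)
    also have "\<dots> = markov (\<lambda>\<omega>. (g \<omega>)\<^sup>2) \<omega> - m\<^sup>2"
      by (simp add: markov_def m_def sum_q[OF \<omega>] power2_eq_square del: One_nat_def)
    finally show "(markov g \<omega>)\<^sup>2 \<le> markov (\<lambda>\<omega>. (g \<omega>)\<^sup>2) \<omega>" by (simp add: m_def)
  qed
  also have "\<dots> = (\<integral>\<omega>. (g \<omega>)\<^sup>2 \<partial>P)"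
    by (rule integral_markov[OF _ g2]) auto
  finally show ?thesis .
qed

text \<open>The conditional mean square of the increment of \<open>g\<close> over one step of the environment chain; its
  integral, the energy of \<open>g\<close>, is twice the Dirichlet form.\<close>
definition dirichlet :: "('w \<Rightarrow> real) \<Rightarrow> 'w \<Rightarrow> real" where
  "dirichlet g \<omega> = (\<Sum>i=1..N. q i \<omega> * (g (\<tau> (d i) \<omega>) - g \<omega>)\<^sup>2)"

lemma dirichlet_measurable [measurable]:
  assumes [measurable]: "g \<in> borel_measurable P" shows "dirichlet g \<in> borel_measurable P"
  unfolding dirichlet_def[abs_def] by measurable

lemma dirichlet_nonneg: "\<omega> \<in> space P \<Longrightarrow> 0 \<le> dirichlet g \<omega>"
  unfolding dirichlet_def by (intro sum_nonneg) (auto simp: q_nonneg)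

lemma dirichlet_bounded:
  assumes B: "\<And>\<omega>. \<omega> \<in> space P \<Longrightarrow> \<bar>g \<omega>\<bar> \<le> B" and \<omega>: "\<omega> \<in> space P"
  shows "\<bar>dirichlet g \<omega>\<bar> \<le> (2 * B)\<^sup>2"
  unfolding dirichlet_def
proof (rule q_average_abs_le[OF \<omega>])
  fix i
  have "\<bar>g (\<tau> (d i) \<omega>) - g \<omega>\<bar> \<le> 2 * B"
    using B[of "\<tau> (d i) \<omega>"] B[of \<omega>] \<omega> by simp
  from power_mono[OF this abs_ge_zero, where n=2]
  show "\<bar>(g (\<tau> (d i) \<omega>) - g \<omega>)\<^sup>2\<bar> \<le> (2 * B)\<^sup>2" by simp
qed

lemma integral_dirichlet:
  assumes g[measurable]: "g \<in> borel_measurable P" and B: "\<And>\<omega>. \<omega> \<in> space P \<Longrightarrow> \<bar>g \<omega>\<bar> \<le> B"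
  shows "(\<integral>\<omega>. dirichlet g \<omega> \<partial>P) = 2 * (\<integral>\<omega>. (g \<omega>)\<^sup>2 \<partial>P) - 2 * (\<integral>\<omega>. g \<omega> * markov g \<omega> \<partial>P)"
proof -
  have g2: "\<bar>(g \<omega>)\<^sup>2\<bar> \<le> B\<^sup>2" if "\<omega> \<in> space P" for \<omega>
    using power_mono[OF B[OF that] abs_ge_zero, of 2] by simp
  have gm: "\<bar>g \<omega> * markov g \<omega>\<bar> \<le> B\<^sup>2" if "\<omega> \<in> space P" for \<omega>
    using mult_mono[OF B[OF that] markov_bounded[OF B that]] B[OF that]
    by (auto simp: abs_mult power2_eq_square)
  have i: "integrable P (\<lambda>\<omega>. (g \<omega>)\<^sup>2)" "integrable P (\<lambda>\<omega>. g \<omega> * markov g \<omega>)"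
      "integrable P (markov (\<lambda>\<omega>. (g \<omega>)\<^sup>2))"
    using g2 gm markov_bounded[where g="\<lambda>\<omega>. (g \<omega>)\<^sup>2", OF g2]
    by (auto intro!: integrable_bounded[where B="B\<^sup>2"])
  have "dirichlet g \<omega> = markov (\<lambda>\<omega>. (g \<omega>)\<^sup>2) \<omega> - 2 * (g \<omega> * markov g \<omega>) + (g \<omega>)\<^sup>2"
    if \<omega>: "\<omega> \<in> space P" for \<omega>
  proof -
    have "dirichlet g \<omega> = markov (\<lambda>\<omega>. (g \<omega>)\<^sup>2) \<omega> - 2 * (g \<omega> * markov g \<omega>) + (g \<omega>)\<^sup>2 * (\<Sum>i=1..N. q i \<omega>)"
      unfolding dirichlet_def markov_def
      by (simp add: power2_eq_square algebra_simps sum.distrib sum_subtractf sum_distrib_left)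
    then show ?thesis by (simp add: sum_q[OF \<omega>] del: One_nat_def)
  qed
  then have "(\<integral>\<omega>. dirichlet g \<omega> \<partial>P) =
      (\<integral>\<omega>. markov (\<lambda>\<omega>. (g \<omega>)\<^sup>2) \<omega> - 2 * (g \<omega> * markov g \<omega>) + (g \<omega>)\<^sup>2 \<partial>P)"
    by (intro Bochner_Integration.integral_cong) auto
  also have "\<dots> = (\<integral>\<omega>. (g \<omega>)\<^sup>2 \<partial>P) - 2 * (\<integral>\<omega>. g \<omega> * markov g \<omega> \<partial>P) + (\<integral>\<omega>. (g \<omega>)\<^sup>2 \<partial>P)"
    using i integral_markov[where g="\<lambda>\<omega>. (g \<omega>)\<^sup>2", OF _ g2] by simp
  finally show ?thesis by simp
qed

text \<open>Zero energy means that \<open>g\<close> does not change over any possible step. Since this holds almost surely in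
  all the countably many shifted environments at once, \<open>g\<close> is constant along every path of the walk,
  and irreducibility lets paths from \<open>0\<close> reach every site.\<close>
lemma invariant_if_dirichlet_zero:
  assumes "AE \<omega> in P. dirichlet g \<omega> = 0"
  shows "AE \<omega> in P. \<forall>y. g (\<tau> y \<omega>) = g \<omega>"
  using AE_tau[OF assms] irreducible AE_space
proof eventually_elim
  case (elim \<omega>)
  have step: "g (\<tau> b \<omega>) = g (\<tau> a \<omega>)" if "p \<omega> a b \<noteq> 0" for a b
  proof -
    have "b - a \<in> \<Lambda>" using that finite_range(2) elim by blast
    then obtain i where i: "i \<in> {1..N}" "b = d i + a"
      using enum by (auto simp: bij_betw_def image_iff diff_eq_eq)
    have "q i (\<tau> a \<omega>) * (g (\<tau> (d i) (\<tau> a \<omega>)) - g (\<tau> a \<omega>))\<^sup>2 = 0"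
      using elim(1)[rule_format, of a] i(1) q_nonneg elim(3)
      unfolding dirichlet_def by (subst (asm) sum_nonneg_eq_0_iff) auto
    then show ?thesis using that elim(3) i(2) by (simp add: q_tau tau_tau)
  qed
  show ?case
  proof
    fix y
    obtain n where "1 \<le> n" "0 < n_step (p \<omega>) n 0 y" using elim(2) by blast
    then have "g (\<tau> y \<omega>) = g (\<tau> 0 \<omega>)"
      by (intro n_step_constant[of "p \<omega>" n 0 y "\<lambda>z. g (\<tau> z \<omega>)"]) (auto simp: step)
    then show "g (\<tau> y \<omega>) = g \<omega>" using elim(3) by (simp add: tau_zero)
  qed
qed

text \<open>Ergodicity applies to strictly invariant sets, so the sublevel sets of the almost surely invariant
  \<open>g\<close> are replaced by the sets on which the whole orbit stays below the level. If \<open>g\<close> were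
  below a negative level with positive probability, it would be so almost surely, against its mean being
  zero; so \<open>g \<ge> 0\<close>, and a nonnegative function of mean zero vanishes.\<close>
lemma invariant_mean_zero:
  fixes g :: "'w \<Rightarrow> real"
  assumes g[measurable]: "g \<in> borel_measurable P" and int: "integrable P g"
    and inv: "AE \<omega> in P. \<forall>y. g (\<tau> y \<omega>) = g \<omega>" and mean: "(\<integral>\<omega>. g \<omega> \<partial>P) = 0"
  shows "AE \<omega> in P. g \<omega> = 0"
proof -
  have gt: "AE \<omega> in P. c < g \<omega>" if c: "c < 0" for c
  proof -
    define A where "A = {\<omega> \<in> space P. \<forall>y. g (\<tau> y \<omega>) \<le> c}"
    have A: "A \<in> sets P" unfolding A_def by measurable
    have "\<tau> z -` A \<inter> space P = A" for z
    proof -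
      have "(\<forall>y. g (\<tau> (y + z) \<omega>) \<le> c) = (\<forall>y. g (\<tau> y \<omega>) \<le> c)" for \<omega>
        by (metis diff_add_cancel)
      then show ?thesis unfolding A_def by (auto simp: tau_tau)
    qed
    then have "prob A = 0 \<or> prob A = 1"
      using ergodic A unfolding ergodic_action_def by blast
    moreover have "prob A \<noteq> 1"
    proof
      assume "prob A = 1"
      then have "AE \<omega> in P. \<omega> \<in> A" using A by (simp add: prob_eq_1)
      then have "AE \<omega> in P. g \<omega> \<le> c" using inv
        by eventually_elim (auto simp: A_def)
      then have "(\<integral>\<omega>. g \<omega> \<partial>P) \<le> (\<integral>\<omega>. c \<partial>P)"
        by (intro integral_mono_AE int) auto
      then show False using c mean by (simp add: prob_space)
    qed
    ultimately have "AE \<omega> in P. \<omega> \<notin> A" using A by (simp add: prob_eq_0)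
    then show ?thesis using inv AE_space
      by eventually_elim (auto simp: A_def not_le)
  qed
  have "AE \<omega> in P. \<forall>k. - inverse (real (Suc k)) < g \<omega>"
    unfolding AE_all_countable by (intro allI gt) simp
  then have nonneg: "AE \<omega> in P. 0 \<le> g \<omega>"
  proof eventually_elim
    case (elim \<omega>)
    show ?case
    proof (rule ccontr)
      assume "\<not> 0 \<le> g \<omega>"
      then obtain k where "inverse (real (Suc k)) < - g \<omega>"
        using reals_Archimedean[of "- g \<omega>"] by auto
      then show False using elim[rule_format, of k] by linarith
    qed
  qed
  show ?thesis using integral_nonneg_eq_0_iff_AE[OF int nonneg] mean by simp
qed

text \<open>The core of the ergodic theorem. Let \<open>D\<close> be the infimum of the squared norm over \<open>K\<close>. A minimising
  sequence is Cauchy by the parallelogram law, as midpoints stay in \<open>K\<close>. The same law applied to the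
  midpoint of \<open>g\<close> and \<open>markov g\<close> bounds the energy of \<open>g\<close> by four times the excess of its squared norm over
  \<open>D\<close>. So the limit has zero energy and mean zero, hence vanishes, and \<open>D = 0\<close>.\<close>
lemma hull_small_norm:
  assumes ne: "h \<in> K"
    and meas: "\<And>g. g \<in> K \<Longrightarrow> g \<in> borel_measurable P"
    and B: "\<And>g \<omega>. g \<in> K \<Longrightarrow> \<omega> \<in> space P \<Longrightarrow> \<bar>g \<omega>\<bar> \<le> B"
    and mean: "\<And>g. g \<in> K \<Longrightarrow> (\<integral>\<omega>. g \<omega> \<partial>P) = 0"
    and markov: "\<And>g. g \<in> K \<Longrightarrow> markov g \<in> K"
    and mid: "\<And>f g. f \<in> K \<Longrightarrow> g \<in> K \<Longrightarrow> (\<lambda>\<omega>. (f \<omega> + g \<omega>) / 2) \<in> K"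
    and e: "0 < e"
  shows "\<exists>g\<in>K. (\<integral>\<omega>. (g \<omega>)\<^sup>2 \<partial>P) < e"
proof -
  define E where "E g = (\<integral>\<omega>. (g \<omega>)\<^sup>2 \<partial>P)" for g :: "'w \<Rightarrow> real"
  define D where "D = Inf (E ` K)"
  have bdd: "bdd_below (E ` K)" by (rule bdd_belowI[of _ 0]) (auto simp: E_def)
  have D_le: "D \<le> E g" if "g \<in> K" for g
    unfolding D_def using that bdd by (intro cInf_lower) auto
  have prod_int: "integrable P (\<lambda>\<omega>. f \<omega> * g \<omega>)" if "f \<in> K" "g \<in> K" for f g
  proof (rule integrable_bounded[where B="B * B"])
    show "(\<lambda>\<omega>. f \<omega> * g \<omega>) \<in> borel_measurable P"
      using meas[OF that(1)] meas[OF that(2)] by simp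
    fix \<omega> assume \<omega>: "\<omega> \<in> space P"
    have "0 \<le> B" using B[OF that(1) \<omega>] by linarith
    then show "\<bar>f \<omega> * g \<omega>\<bar> \<le> B * B"
      unfolding abs_mult using B[OF that(1) \<omega>] B[OF that(2) \<omega>] by (intro mult_mono) auto
  qed
  have mid_E: "E (\<lambda>\<omega>. (f \<omega> + g \<omega>) / 2) = (E f + E g + 2 * (\<integral>\<omega>. f \<omega> * g \<omega> \<partial>P)) / 4"
    if "f \<in> K" "g \<in> K" for f g
    using prod_int[OF that] prod_int[OF that(1) that(1)] prod_int[OF that(2) that(2)]
    unfolding E_def by (simp add: power2_eq_square algebra_simps add_divide_distrib)
  (* With this rate the increments of the minimising sequence are summable in mean, so that the sequence
     itself converges almost surely. *)
  have "\<exists>g\<in>K. E g < D + (1/4)^n / 4" for n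
  proof -
    have "Inf (E ` K) < D + (1/4)^n / 4" by (simp add: D_def)
    then show ?thesis using ne cInf_lessD[of "E ` K"] by auto
  qed
  then obtain u where uK: "\<And>n. u n \<in> K" and uE: "\<And>n. E (u n) < D + (1/4)^n / 4" by metis
  have [measurable]: "\<And>n. u n \<in> borel_measurable P" using meas uK by blast
  have u_int: "integrable P (u n)" for n
    using B[OF uK] by (intro integrable_bounded[where B=B]) auto
  have "(\<integral>\<omega>. \<bar>u (Suc n) \<omega> - u n \<omega>\<bar> \<partial>P) \<le> (1/2)^n" for n
  proof -
    let ?v = "\<lambda>\<omega>. u (Suc n) \<omega> - u n \<omega>"
    have i: "integrable P (\<lambda>\<omega>. (?v \<omega>)\<^sup>2)"
      using prod_int[OF uK uK, of n n] prod_int[OF uK uK, of n "Suc n"] prod_int[OF uK uK, of "Suc n" "Suc n"]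
      by (simp add: power2_eq_square algebra_simps)
    have "(\<integral>\<omega>. (?v \<omega>)\<^sup>2 \<partial>P) = E (u (Suc n)) + E (u n) - 2 * (\<integral>\<omega>. u (Suc n) \<omega> * u n \<omega> \<partial>P)"
      using prod_int[OF uK uK, of n n] prod_int[OF uK uK, of "Suc n" n] prod_int[OF uK uK, of "Suc n" "Suc n"]
      unfolding E_def by (simp add: power2_eq_square algebra_simps)
    also have "\<dots> = 2 * E (u (Suc n)) + 2 * E (u n) - 4 * E (\<lambda>\<omega>. (u (Suc n) \<omega> + u n \<omega>) / 2)"
      unfolding mid_E[OF uK uK] by (simp add: field_simps)
    also have "\<dots> \<le> (1/4)^n"
    proof -
      have "(1/4)^Suc n \<le> (1/4 :: real)^n" by simp
      then show ?thesis
        using uE[of n] uE[of "Suc n"] D_le[OF mid[OF uK uK], of "Suc n" n]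
        by (simp only: power_Suc)
    qed
    finally have v2: "(\<integral>\<omega>. (?v \<omega>)\<^sup>2 \<partial>P) \<le> (1/4)^n" .
    have "(\<integral>\<omega>. \<bar>?v \<omega>\<bar> \<partial>P) \<le> (\<integral>\<omega>. ((1/2)^n + 2^n * (?v \<omega>)\<^sup>2) / 2 \<partial>P)"
    proof (intro integral_mono)
      (* Arithmetic and geometric mean, weighted so that both terms have mean at most (1/2)^n. *)
      show "\<bar>?v \<omega>\<bar> \<le> ((1/2)^n + 2^n * (?v \<omega>)\<^sup>2) / 2" for \<omega>
      proof -
        have "0 \<le> 2^n * ((1/2)^n - \<bar>?v \<omega>\<bar>)\<^sup>2" by simp
        also have "\<dots> = (1/2)^n + 2^n * (?v \<omega>)\<^sup>2 - 2 * \<bar>?v \<omega>\<bar>"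
          by (simp add: power2_diff power2_eq_square algebra_simps power_divide)
        finally show ?thesis by simp
      qed
    qed (use u_int i in auto)
    also have "\<dots> = ((1/2)^n + 2^n * (\<integral>\<omega>. (?v \<omega>)\<^sup>2 \<partial>P)) / 2"
      using i by (simp add: prob_space)
    also have "\<dots> \<le> ((1/2)^n + 2^n * (1/4)^n) / 2"
      using v2 by (intro divide_right_mono add_left_mono mult_left_mono) auto
    also have "\<dots> = (1/2)^n" by (simp flip: power_mult_distrib)
    finally show ?thesis .
  qed
  then have "AE \<omega> in P. convergent (\<lambda>n. u n \<omega>)"
    using u_int by (intro AE_convergent_summable_increments)
  define g where "g \<omega> = lim (\<lambda>n. u n \<omega>)" for \<omega>
  (* Convergence along the whole orbit is what makes the energy densities converge as well. *)
  have lim: "AE \<omega> in P. \<forall>z. (\<lambda>n. u n (\<tau> z \<omega>)) \<longlonglongrightarrow> g (\<tau> z \<omega>)"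
    using \<open>AE \<omega> in P. convergent _\<close>
    by (intro AE_tau) (simp add: convergent_LIMSEQ_iff g_def)
  then have lim0: "AE \<omega> in P. (\<lambda>n. u n \<omega>) \<longlonglongrightarrow> g \<omega>"
    using AE_space by eventually_elim (metis tau_zero)
  have [measurable]: "g \<in> borel_measurable P" unfolding g_def[abs_def] by measurable
  have B0: "0 \<le> B" using B[OF ne] not_empty by fastforce
  have g_bound: "AE \<omega> in P. \<bar>g \<omega>\<bar> \<le> B"
    using lim0 AE_space
  proof eventually_elim
    case (elim \<omega>)
    show ?case
      by (rule LIMSEQ_le_const2[OF tendsto_rabs[OF elim(1)]]) (use B[OF uK elim(2)] in auto)
  qed
  have g_int: "integrable P g" using g_bound by (intro integrable_const_bound[where B=B]) auto
  have "(\<lambda>n. \<integral>\<omega>. u n \<omega> \<partial>P) \<longlonglongrightarrow> (\<integral>\<omega>. g \<omega> \<partial>P)"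
    by (rule integral_dominated_convergence[where w="\<lambda>_. B"]) (use lim0 B[OF uK] in auto)
  then have g_mean: "(\<integral>\<omega>. g \<omega> \<partial>P) = 0"
    using mean[OF uK] LIMSEQ_unique by (simp add: LIMSEQ_const_iff)
  have E_lim: "(\<lambda>n. E (u n)) \<longlonglongrightarrow> E g"
    unfolding E_def
  proof (rule integral_dominated_convergence[where w="\<lambda>_. B\<^sup>2"])
    show "AE \<omega> in P. (\<lambda>n. (u n \<omega>)\<^sup>2) \<longlonglongrightarrow> (g \<omega>)\<^sup>2"
      using lim0 by eventually_elim (rule tendsto_power)
    show "AE \<omega> in P. norm ((u n \<omega>)\<^sup>2) \<le> B\<^sup>2" for n
      using power_mono[OF B[OF uK] abs_ge_zero, of _ n 2] by auto
  qed auto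
  have dir_lim: "(\<lambda>n. \<integral>\<omega>. dirichlet (u n) \<omega> \<partial>P) \<longlonglongrightarrow> (\<integral>\<omega>. dirichlet g \<omega> \<partial>P)"
  proof (rule integral_dominated_convergence[where w="\<lambda>_. (2 * B)\<^sup>2"])
    show "AE \<omega> in P. (\<lambda>n. dirichlet (u n) \<omega>) \<longlonglongrightarrow> dirichlet g \<omega>"
      using lim lim0
    proof eventually_elim
      case (elim \<omega>)
      then show ?case unfolding dirichlet_def
        by (intro tendsto_sum tendsto_mult tendsto_const tendsto_power tendsto_diff) auto
    qed
    show "AE \<omega> in P. norm (dirichlet (u n) \<omega>) \<le> (2 * B)\<^sup>2" for n
      using dirichlet_bounded[OF B[OF uK]] by auto
  qed auto
  have dir_le: "(\<integral>\<omega>. dirichlet (u n) \<omega> \<partial>P) \<le> (1/4)^n" for n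
  proof -
    have "4 * D \<le> E (u n) + E (markov (u n)) + 2 * (\<integral>\<omega>. u n \<omega> * markov (u n) \<omega> \<partial>P)"
      using D_le[OF mid[OF uK markov[OF uK]], of n n] unfolding mid_E[OF uK markov[OF uK]] by simp
    moreover have "E (markov (u n)) \<le> E (u n)"
      unfolding E_def by (rule markov_square_le) (use B[OF uK] in auto)
    moreover have "(\<integral>\<omega>. dirichlet (u n) \<omega> \<partial>P) = 2 * E (u n) - 2 * (\<integral>\<omega>. u n \<omega> * markov (u n) \<omega> \<partial>P)"
      unfolding E_def by (rule integral_dirichlet) (use B[OF uK] in auto)
    ultimately show ?thesis using uE[of n] by linarith
  qed
  have "(\<lambda>n. (1/4)^n :: real) \<longlonglongrightarrow> 0" by (rule LIMSEQ_power_zero) simp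
  then have "(\<integral>\<omega>. dirichlet g \<omega> \<partial>P) \<le> 0"
    by (rule LIMSEQ_le[OF dir_lim]) (use dir_le in auto)
  moreover have dir_nn: "AE \<omega> in P. 0 \<le> dirichlet g \<omega>" by (auto simp: dirichlet_nonneg)
  ultimately have dir0: "(\<integral>\<omega>. dirichlet g \<omega> \<partial>P) = 0"
    using integral_nonneg_AE[OF dir_nn] by simp
  have "integrable P (dirichlet g)"
  proof (rule integrable_const_bound[where B="(2 * B)\<^sup>2"])
    show "AE \<omega> in P. norm (dirichlet g \<omega>) \<le> (2 * B)\<^sup>2"
      using AE_tau[OF g_bound] g_bound AE_space
    proof eventually_elim
      case (elim \<omega>)
      have "\<bar>(g (\<tau> (d i) \<omega>) - g \<omega>)\<^sup>2\<bar> \<le> (2 * B)\<^sup>2" for i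
      proof -
        have "\<bar>g (\<tau> (d i) \<omega>) - g \<omega>\<bar> \<le> 2 * B"
          using elim(1)[rule_format, of "d i"] elim(2) by linarith
        from power_mono[OF this abs_ge_zero, where n=2] show ?thesis by simp
      qed
      then show ?case
        unfolding dirichlet_def real_norm_def by (intro q_average_abs_le elim)
    qed
  qed auto
  then have "AE \<omega> in P. dirichlet g \<omega> = 0"
    using integral_nonneg_eq_0_iff_AE[OF _ dir_nn] dir0 by simp
  then have "AE \<omega> in P. g \<omega> = 0"
    using invariant_mean_zero[OF _ g_int invariant_if_dirichlet_zero g_mean] by simp
  then have "E g = (\<integral>\<omega>. 0 \<partial>P)"
    unfolding E_def by (intro integral_cong_AE) auto
  then have "(\<lambda>n. E (u n)) \<longlonglongrightarrow> 0" using E_lim by simp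
  then have "eventually (\<lambda>n. E (u n) < e) sequentially" using e by (rule order_tendstoD(2))
  then obtain n where "E (u n) < e" by (auto simp: eventually_sequentially)
  then show ?thesis using uK unfolding E_def by blast
qed

end

section \<open>The skew product and its first step\<close>

abbreviation unit_lebesgue :: "real measure" where
  "unit_lebesgue \<equiv> restrict_space lborel {0..<1}"

lemma prob_space_unit_lebesgue: "prob_space unit_lebesgue"
  by (rule prob_space_restrict_space) auto

context particle_view
begin

abbreviation \<mu> :: "(real \<times> 'w) measure" where "\<mu> \<equiv> pvp_measure P"
abbreviation T :: "real \<times> 'w \<Rightarrow> real \<times> 'w" where "T \<equiv> pvp_map \<tau> p d N"
abbreviation br :: "real \<times> 'w \<Rightarrow> nat" where "br \<equiv> branch p d N"
abbreviation \<phi> :: "real \<times> 'w \<Rightarrow> real" where "\<phi> \<equiv> internal_dynamics p d N"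

sublocale unit: prob_space unit_lebesgue by (rule prob_space_unit_lebesgue)
sublocale pvp: pair_prob_space unit_lebesgue P ..
sublocale skew: prob_space "pvp_measure P"
  unfolding pvp_measure_def by (rule pvp.P.prob_space_axioms)

lemma measure_unit [simp]: "measure unit_lebesgue {0..<1} = 1"
  using unit.prob_space by (simp add: space_restrict_space)

lemma space_pvp: "space \<mu> = {0..<1} \<times> space P"
  by (auto simp: pvp_measure_def space_pair_measure space_restrict_space)

lemma cut_eq_sum: "cut p d \<omega> i = (\<Sum>j=1..i. q j \<omega>)"
  by (induction i) (auto simp: q_def)

lemma cut_mono: "\<omega> \<in> space P \<Longrightarrow> i \<le> j \<Longrightarrow> cut p d \<omega> i \<le> cut p d \<omega> j"
  unfolding cut_eq_sum by (intro sum_mono2) (auto simp: q_nonneg)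

lemma cut_N: "\<omega> \<in> space P \<Longrightarrow> cut p d \<omega> N = 1"
  unfolding cut_eq_sum by (rule sum_q)

lemma cut_diff: "1 \<le> i \<Longrightarrow> cut p d \<omega> i = cut p d \<omega> (i - 1) + q i \<omega>"
  by (cases i) (auto simp: q_def)

lemma cut_measurable [measurable]: "(\<lambda>\<omega>. cut p d \<omega> i) \<in> borel_measurable P"
  unfolding cut_eq_sum by measurable

lemma branch_exists:
  assumes "\<omega> \<in> space P" "0 \<le> s" "s < 1"
  shows "\<exists>i. i \<in> {1..N} \<and> s \<in> {cut p d \<omega> (i - 1)..<cut p d \<omega> i}"
proof -
  define i where "i = (LEAST i. s < cut p d \<omega> i)"
  have ex: "s < cut p d \<omega> N" using assms cut_N by simp
  have i: "s < cut p d \<omega> i" unfolding i_def by (rule LeastI[of _ N]) (rule ex)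
  have "i \<le> N" unfolding i_def by (rule Least_le) (rule ex)
  moreover have "i \<noteq> 0" using i assms by (auto intro!: gr0I)
  moreover have "\<not> s < cut p d \<omega> (i - 1)"
    using not_less_Least[of "i - 1" "\<lambda>i. s < cut p d \<omega> i"] \<open>i \<noteq> 0\<close> unfolding i_def[symmetric] by simp
  ultimately show ?thesis using i by (intro exI[of _ i]) auto
qed

lemma branch_unique:
  assumes "\<omega> \<in> space P"
    and "s \<in> {cut p d \<omega> (i - 1)..<cut p d \<omega> i}" "s \<in> {cut p d \<omega> (j - 1)..<cut p d \<omega> j}"
  shows "i = j"
proof -
  have *: "\<not> k < l" if "s \<in> {cut p d \<omega> (k - 1)..<cut p d \<omega> k}" "s \<in> {cut p d \<omega> (l - 1)..<cut p d \<omega> l}"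
    for k l
    using cut_mono[OF assms(1), of k "l - 1"] that by (cases l) auto
  show ?thesis using *[of i j] *[of j i] assms(2,3) by simp
qed

lemma branch_eqI:
  assumes "\<omega> \<in> space P" "i \<in> {1..N}" "s \<in> {cut p d \<omega> (i - 1)..<cut p d \<omega> i}"
  shows "br (s, \<omega>) = i"
  unfolding branch_def case_prod_conv
  by (rule the_equality) (use assms branch_unique[OF assms(1)] in blast)+

lemma branch_props:
  assumes "m \<in> space \<mu>"
  shows "br m \<in> {1..N}" "cut p d (snd m) (br m - 1) \<le> fst m" "fst m < cut p d (snd m) (br m)"
proof -
  obtain s \<omega> where m: "m = (s, \<omega>)" by (cases m)
  have \<omega>: "\<omega> \<in> space P" and s: "0 \<le> s" "s < 1" using assms by (auto simp: m space_pvp)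
  obtain i where i: "i \<in> {1..N}" "s \<in> {cut p d \<omega> (i - 1)..<cut p d \<omega> i}"
    using branch_exists[OF \<omega> s] by blast
  have "br m = i" unfolding m by (rule branch_eqI[OF \<omega> i])
  then show "br m \<in> {1..N}" "cut p d (snd m) (br m - 1) \<le> fst m" "fst m < cut p d (snd m) (br m)"
    using i by (auto simp: m)
qed

lemma fst_measurable [measurable]: "fst \<in> borel_measurable \<mu>"
proof -
  have "(\<lambda>m. fst m) \<in> measurable \<mu> unit_lebesgue" unfolding pvp_measure_def by measurable
  then show ?thesis using measurable_restrict_space2_iff[of fst \<mu> lborel] by simp
qed

lemma snd_measurable [measurable]: "snd \<in> measurable \<mu> P"
  unfolding pvp_measure_def by measurable

lemma branch_measurable [measurable]: "br \<in> measurable \<mu> (count_space UNIV)"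
proof -
  have "(\<lambda>m. THE i. i \<in> {1..N} \<and> fst m \<in> {cut p d (snd m) (i - 1)..<cut p d (snd m) i})
      \<in> measurable \<mu> (count_space UNIV)"
  proof (rule measurable_THE[where I="{1..N}"])
    fix i
    show "Measurable.pred \<mu> (\<lambda>m. i \<in> {1..N} \<and> fst m \<in> {cut p d (snd m) (i - 1)..<cut p d (snd m) i})"
      unfolding atLeastLessThan_iff by measurable
  qed (use branch_unique space_pvp in \<open>auto\<close>)
  then show ?thesis by (simp add: branch_def case_prod_beta')
qed

lemma snd_T: "snd (T m) = \<tau> (d (br m)) (snd m)"
  by (cases m) (simp add: pvp_map_def displacement_def)

lemma fst_T: "fst (T m) = (fst m - cut p d (snd m) (br m - 1)) / q (br m) (snd m)"
  by (cases m) (simp add: pvp_map_def internal_dynamics_def Let_def q_def field_simps)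

lemma T_space: assumes "m \<in> space \<mu>" shows "T m \<in> space \<mu>"
proof -
  have "snd m \<in> space P" using assms by (auto simp: space_pvp)
  moreover have "0 \<le> fst (T m)" "fst (T m) < 1"
    using branch_props[OF assms] cut_diff[of "br m" "snd m"]
    by (auto simp: fst_T divide_simps)
  ultimately show ?thesis by (simp add: space_pvp mem_Times_iff snd_T)
qed

lemma T_measurable [measurable]: "T \<in> measurable \<mu> \<mu>"
proof -
  have "(\<lambda>m. (fst m - cut p d (snd m) (br m - 1)) / q (br m) (snd m)) \<in> borel_measurable \<mu>"
    by (rule measurable_compose_countable[where g=br and f="\<lambda>i m. (fst m - cut p d (snd m) (i - 1)) / q i (snd m)"])
       measurable
  then have "(\<lambda>m. fst (T m)) \<in> borel_measurable \<mu>" by (simp add: fst_T)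
  then have 1: "(\<lambda>m. fst (T m)) \<in> measurable \<mu> unit_lebesgue"
    using T_space by (intro measurable_restrict_space2) (auto simp: space_pvp mem_Times_iff)
  have "(\<lambda>m. \<tau> (d (br m)) (snd m)) \<in> measurable \<mu> P"
    by (rule measurable_compose_countable[where g=br and f="\<lambda>i m. \<tau> (d i) (snd m)"]) measurable
  then have 2: "(\<lambda>m. snd (T m)) \<in> measurable \<mu> P" by (simp add: snd_T)
  have "(\<lambda>m. (fst (T m), snd (T m))) \<in> measurable \<mu> (unit_lebesgue \<Otimes>\<^sub>M P)"
    by (intro measurable_Pair 1 2)
  then show ?thesis by (simp add: pvp_measure_def)
qed

lemma T_funpow_measurable [measurable]: "(T ^^ n) \<in> measurable \<mu> \<mu>"
  by (induction n) (auto intro: measurable_comp)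

lemma T_funpow_space: "m \<in> space \<mu> \<Longrightarrow> (T ^^ n) m \<in> space \<mu>"
  by (induction n) (auto simp: T_space)

text \<open>On the interval of the \<open>i\<close>-th branch the internal coordinate runs affinely through the whole unit
  interval, so after the first step it is again uniform, independently of the branch taken.\<close>
lemma first_step:
  fixes F :: "nat \<Rightarrow> real \<Rightarrow> 'b::{banach, second_countable_topology}"
  assumes \<omega>: "\<omega> \<in> space P" and F: "\<And>i. i \<in> {1..N} \<Longrightarrow> integrable unit_lebesgue (F i)"
  shows "(\<integral>s. F (br (s, \<omega>)) (fst (T (s, \<omega>))) \<partial>unit_lebesgue) =
    (\<Sum>i=1..N. q i \<omega> *\<^sub>R (\<integral>s. F i s \<partial>unit_lebesgue))"
proof -
  let ?c = "cut p d \<omega>"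
  have piece: "has_bochner_integral lborel
      (\<lambda>s. indicator {?c (i - 1)..<?c i} s *\<^sub>R F i ((s - ?c (i - 1)) / q i \<omega>))
      (q i \<omega> *\<^sub>R (\<integral>s. F i s \<partial>unit_lebesgue))" if i: "i \<in> {1..N}" for i
  proof (cases "q i \<omega> = 0")
    case True
    then have "{?c (i - 1)..<?c i} = {}" using cut_diff[of i \<omega>] i by simp
    then show ?thesis using True by (simp add: has_bochner_integral_zero)
  next
    case False
    then have q: "0 < q i \<omega>" using q_nonneg[OF \<omega>, of i] by simp
    have ind: "indicator {?c (i - 1)..<?c i} (?c (i - 1) + q i \<omega> * x) = (indicator {0..<1} x :: real)" for x
      using cut_diff[of i \<omega>] i q mult_less_cancel_left_pos[OF q, of x 1]
      by (auto simp: indicator_def zero_le_mult_iff)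
    have "has_bochner_integral lborel (\<lambda>x. indicator {0..<1} x *\<^sub>R F i x) (\<integral>s. F i s \<partial>unit_lebesgue)"
      using F[OF i] by (simp add: has_bochner_integral_iff integrable_restrict_space integral_restrict_space)
    then show ?thesis
      using q by (subst lborel_has_bochner_integral_real_affine_iff[where c="q i \<omega>" and t="?c (i - 1)"])
        (simp_all add: ind del: One_nat_def)
  qed
  have "indicator {0..<1} s *\<^sub>R F (br (s, \<omega>)) (fst (T (s, \<omega>))) =
      (\<Sum>i=1..N. indicator {?c (i - 1)..<?c i} s *\<^sub>R F i ((s - ?c (i - 1)) / q i \<omega>))" for s
  proof (cases "s \<in> {0..<1}")
    case True
    then have m: "(s, \<omega>) \<in> space \<mu>" using \<omega> by (simp add: space_pvp)
    note b = branch_props[OF m]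
    have "(\<Sum>i=1..N. indicator {?c (i - 1)..<?c i} s *\<^sub>R F i ((s - ?c (i - 1)) / q i \<omega>)) =
        (\<Sum>i=1..N. if i = br (s, \<omega>) then F i ((s - ?c (i - 1)) / q i \<omega>) else 0)"
    proof (intro sum.cong refl)
      fix i assume i: "i \<in> {1..N}"
      show "indicator {?c (i - 1)..<?c i} s *\<^sub>R F i ((s - ?c (i - 1)) / q i \<omega>) =
          (if i = br (s, \<omega>) then F i ((s - ?c (i - 1)) / q i \<omega>) else 0)"
      proof (cases "i = br (s, \<omega>)")
        case True
        then have "s \<in> {?c (i - 1)..<?c i}" using b by simp
        then show ?thesis using True by simp
      next
        case False
        then have "s \<notin> {?c (i - 1)..<?c i}" using branch_eqI[OF \<omega> i] by blast
        then show ?thesis using False by simp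
      qed
    qed
    also have "\<dots> = F (br (s, \<omega>)) (fst (T (s, \<omega>)))"
      using b by (simp add: fst_T)
    finally show ?thesis using True by simp
  next
    case False
    have "s \<notin> {?c (i - 1)..<?c i}" if "i \<in> {1..N}" for i
      using False cut_mono[OF \<omega>, of 0 "i - 1"] cut_mono[OF \<omega>, of i N] cut_N[OF \<omega>] that by auto
    then have "(\<Sum>i=1..N. indicator {?c (i - 1)..<?c i} s *\<^sub>R F i ((s - ?c (i - 1)) / q i \<omega>)) = 0"
      by (intro sum.neutral) (simp add: indicator_def)
    then show ?thesis using False by simp
  qed
  then have "has_bochner_integral lborel (\<lambda>s. indicator {0..<1} s *\<^sub>R F (br (s, \<omega>)) (fst (T (s, \<omega>))))
      (\<Sum>i=1..N. q i \<omega> *\<^sub>R (\<integral>s. F i s \<partial>unit_lebesgue))"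
    by (simp only:) (intro has_bochner_integral_sum piece)
  then show ?thesis
    by (simp add: has_bochner_integral_iff integral_restrict_space)
qed

lemma integrable_pvp:
  fixes G :: "real \<times> 'w \<Rightarrow> 'b::{banach, second_countable_topology}"
  assumes "G \<in> borel_measurable \<mu>" "\<And>m. m \<in> space \<mu> \<Longrightarrow> norm (G m) \<le> B"
  shows "integrable \<mu> G"
  using assms by (intro skew.integrable_const_bound[where B=B]) auto

lemma section_measurable:
  assumes "G \<in> borel_measurable \<mu>" "\<omega> \<in> space P"
  shows "(\<lambda>s. G (s, \<omega>)) \<in> borel_measurable unit_lebesgue"
  using assms unfolding pvp_measure_def by (rule measurable_Pair1)

lemma integrable_section:
  fixes G :: "real \<times> 'w \<Rightarrow> 'b::{banach, second_countable_topology}"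
  assumes "G \<in> borel_measurable \<mu>" "\<And>m. m \<in> space \<mu> \<Longrightarrow> norm (G m) \<le> B" "\<omega> \<in> space P"
  shows "integrable unit_lebesgue (\<lambda>s. G (s, \<omega>))"
  using assms section_measurable[OF assms(1,3)]
  by (intro unit.integrable_const_bound[where B=B]) (auto simp: space_pvp space_restrict_space)

text \<open>The Markov property at time one, for a fixed environment. The dependence of \<open>G\<close> on its first argument records the step just taken.\<close>
lemma first_step_quenched:
  fixes G :: "nat \<Rightarrow> real \<times> 'w \<Rightarrow> 'b::{banach, second_countable_topology}"
  assumes \<omega>: "\<omega> \<in> space P"
    and G: "\<And>i. i \<in> {1..N} \<Longrightarrow> G i \<in> borel_measurable \<mu>"
      "\<And>i m. i \<in> {1..N} \<Longrightarrow> m \<in> space \<mu> \<Longrightarrow> norm (G i m) \<le> B"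
  shows "(\<integral>s. G (br (s, \<omega>)) (T (s, \<omega>)) \<partial>unit_lebesgue) =
    (\<Sum>i=1..N. q i \<omega> *\<^sub>R (\<integral>s. G i (s, \<tau> (d i) \<omega>) \<partial>unit_lebesgue))"
proof -
  have "T (s, \<omega>) = (fst (T (s, \<omega>)), \<tau> (d (br (s, \<omega>))) \<omega>)" for s
    using snd_T[of "(s, \<omega>)"] by (metis prod.collapse snd_conv)
  then have "(\<integral>s. G (br (s, \<omega>)) (T (s, \<omega>)) \<partial>unit_lebesgue) =
      (\<integral>s. G (br (s, \<omega>)) (fst (T (s, \<omega>)), \<tau> (d (br (s, \<omega>))) \<omega>) \<partial>unit_lebesgue)"
    by (intro Bochner_Integration.integral_cong refl) simp
  also have "\<dots> = (\<Sum>i=1..N. q i \<omega> *\<^sub>R (\<integral>s. G i (s, \<tau> (d i) \<omega>) \<partial>unit_lebesgue))"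
    by (rule first_step[OF \<omega>, of "\<lambda>i s. G i (s, \<tau> (d i) \<omega>)"])
       (use G \<omega> in \<open>auto intro!: integrable_section[where B=B]\<close>)
  finally show ?thesis .
qed

lemma integral_pvp:
  fixes G :: "real \<times> 'w \<Rightarrow> 'b::{banach, second_countable_topology}"
  assumes "integrable \<mu> G"
  shows "(\<integral>m. G m \<partial>\<mu>) = (\<integral>\<omega>. (\<integral>s. G (s, \<omega>) \<partial>unit_lebesgue) \<partial>P)"
  using pvp.integral_snd[of "\<lambda>s \<omega>. G (s, \<omega>)"] assms unfolding pvp_measure_def by simp

lemma quenched_measurable:
  fixes G :: "real \<times> 'w \<Rightarrow> 'b::{banach, second_countable_topology}"
  assumes [measurable]: "G \<in> borel_measurable \<mu>"
  shows "(\<lambda>\<omega>. \<integral>s. G (s, \<omega>) \<partial>unit_lebesgue) \<in> borel_measurable P"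
proof -
  have "(\<lambda>(\<omega>, s). G (s, \<omega>)) \<in> borel_measurable (P \<Otimes>\<^sub>M unit_lebesgue)"
    using measurable_compose[OF measurable_pair_swap' assms[unfolded pvp_measure_def]]
    by (simp add: case_prod_beta')
  then show ?thesis by (intro unit.borel_measurable_lebesgue_integral) simp
qed

lemma quenched_bounded:
  fixes G :: "real \<times> 'w \<Rightarrow> 'b::{banach, second_countable_topology}"
  assumes G: "G \<in> borel_measurable \<mu>" "\<And>m. m \<in> space \<mu> \<Longrightarrow> norm (G m) \<le> B" and \<omega>: "\<omega> \<in> space P"
  shows "norm (\<integral>s. G (s, \<omega>) \<partial>unit_lebesgue) \<le> B"
proof -
  have "norm (\<integral>s. G (s, \<omega>) \<partial>unit_lebesgue) \<le> (\<integral>s. norm (G (s, \<omega>)) \<partial>unit_lebesgue)"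
    by (rule integral_norm_bound)
  also have "\<dots> \<le> (\<integral>s. B \<partial>unit_lebesgue)"
    using integrable_section[OF G \<omega>] G(2) \<omega>
    by (intro integral_mono) (auto simp: space_pvp space_restrict_space)
  also have "\<dots> = B" by (simp add: unit.prob_space)
  finally show ?thesis .
qed

text \<open>By the first-step decomposition, averaging over the internal coordinate turns \<open>T\<close> into the transition
  operator, so invariance of \<open>\<mu>\<close> is stationarity of the environment.\<close>
lemma integral_T:
  fixes G :: "real \<times> 'w \<Rightarrow> real"
  assumes G: "G \<in> borel_measurable \<mu>" "\<And>m. m \<in> space \<mu> \<Longrightarrow> \<bar>G m\<bar> \<le> B"
  shows "(\<integral>m. G (T m) \<partial>\<mu>) = (\<integral>m. G m \<partial>\<mu>)"
proof -
  define Q where "Q \<omega> = (\<integral>s. G (s, \<omega>) \<partial>unit_lebesgue)" for \<omega>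
  have [measurable]: "Q \<in> borel_measurable P"
    unfolding Q_def[abs_def] by (rule quenched_measurable[OF G(1)])
  have QB: "\<bar>Q \<omega>\<bar> \<le> B" if "\<omega> \<in> space P" for \<omega>
    unfolding Q_def using quenched_bounded[OF G(1) _ that, of B] G(2) by simp
  have "(\<integral>m. G (T m) \<partial>\<mu>) = (\<integral>\<omega>. (\<integral>s. G (T (s, \<omega>)) \<partial>unit_lebesgue) \<partial>P)"
    using G T_space measurable_compose[OF T_measurable G(1)]
    by (intro integral_pvp integrable_pvp[where B=B]) auto
  also have "\<dots> = (\<integral>\<omega>. markov Q \<omega> \<partial>P)"
    using G unfolding markov_def Q_def
    by (intro Bochner_Integration.integral_cong refl)
       (simp add: first_step_quenched[where G="\<lambda>_. G" and B=B])
  also have "\<dots> = (\<integral>\<omega>. Q \<omega> \<partial>P)" by (rule integral_markov[OF _ QB]) auto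
  also have "\<dots> = (\<integral>m. G m \<partial>\<mu>)"
    unfolding Q_def using G by (intro integral_pvp[symmetric] integrable_pvp[where B=B]) auto
  finally show ?thesis .
qed

lemma integral_T_funpow:
  fixes G :: "real \<times> 'w \<Rightarrow> real"
  assumes G: "G \<in> borel_measurable \<mu>" "\<And>m. m \<in> space \<mu> \<Longrightarrow> \<bar>G m\<bar> \<le> B"
  shows "(\<integral>m. G ((T ^^ n) m) \<partial>\<mu>) = (\<integral>m. G m \<partial>\<mu>)"
proof (induction n)
  case (Suc n)
  have "(\<integral>m. G ((T ^^ Suc n) m) \<partial>\<mu>) = (\<integral>m. G ((T ^^ n) (T m)) \<partial>\<mu>)"
    by (simp only: funpow_Suc_right comp_def)
  also have "\<dots> = (\<integral>m. G ((T ^^ n) m) \<partial>\<mu>)"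
    using measurable_compose[OF T_funpow_measurable G(1)] G(2) T_funpow_space
    by (intro integral_T[of "\<lambda>m. G ((T ^^ n) m)" B]) auto
  finally show ?case using Suc by simp
qed simp

lemma integral_environment:
  fixes f :: "'w \<Rightarrow> real"
  assumes [measurable]: "f \<in> borel_measurable P" and "\<And>\<omega>. \<omega> \<in> space P \<Longrightarrow> \<bar>f \<omega>\<bar> \<le> B"
  shows "(\<integral>m. f (snd m) \<partial>\<mu>) = (\<integral>\<omega>. f \<omega> \<partial>P)"
proof -
  have "(\<integral>m. f (snd m) \<partial>\<mu>) = (\<integral>\<omega>. (\<integral>s. f (snd (s, \<omega>)) \<partial>unit_lebesgue) \<partial>P)"
    using assms by (intro integral_pvp integrable_pvp[where B=B]) (auto simp: space_pvp)
  then show ?thesis by (simp add: unit.prob_space)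
qed

section \<open>Martingales and the mean ergodic theorem along the walk\<close>

text \<open>The summand may depend on the step taken at time \<open>k\<close> as well as on the environment before it, so that
  the displacement, the conditional variances and martingale differences are all covered.\<close>
definition birkhoff :: "(nat \<Rightarrow> 'w \<Rightarrow> real) \<Rightarrow> nat \<Rightarrow> real \<times> 'w \<Rightarrow> real" where
  "birkhoff \<psi> n m = (\<Sum>k<n. \<psi> (br ((T ^^ k) m)) (snd ((T ^^ k) m)))"

lemma birkhoff_0 [simp]: "birkhoff \<psi> 0 m = 0"
  by (simp add: birkhoff_def)

lemma birkhoff_Suc: "birkhoff \<psi> (Suc n) m = \<psi> (br m) (snd m) + birkhoff \<psi> n (T m)"
  by (simp add: birkhoff_def sum.lessThan_Suc_shift funpow_swap1 del: sum.lessThan_Suc)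

lemma current_measurable [measurable]:
  fixes \<psi> :: "nat \<Rightarrow> 'w \<Rightarrow> real"
  assumes [measurable]: "\<And>i. \<psi> i \<in> borel_measurable P"
  shows "(\<lambda>m. \<psi> (br m) (snd m)) \<in> borel_measurable \<mu>"
  by (rule measurable_compose_countable[where g=br and f="\<lambda>i m. \<psi> i (snd m)"]) measurable

lemma birkhoff_measurable [measurable]:
  assumes [measurable]: "\<And>i. \<psi> i \<in> borel_measurable P"
  shows "birkhoff \<psi> n \<in> borel_measurable \<mu>"
  unfolding birkhoff_def[abs_def]
  by (intro borel_measurable_sum measurable_compose[OF T_funpow_measurable current_measurable]) measurable

lemma current_bounded:
  assumes "\<And>i \<omega>. i \<in> {1..N} \<Longrightarrow> \<omega> \<in> space P \<Longrightarrow> \<bar>\<psi> i \<omega>\<bar> \<le> B" "m \<in> space \<mu>"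
  shows "\<bar>\<psi> (br m) (snd m)\<bar> \<le> (B::real)"
  using assms branch_props(1)[OF assms(2)] by (auto simp: space_pvp)

lemma birkhoff_bounded:
  assumes B: "\<And>i \<omega>. i \<in> {1..N} \<Longrightarrow> \<omega> \<in> space P \<Longrightarrow> \<bar>\<psi> i \<omega>\<bar> \<le> B" and m: "m \<in> space \<mu>"
  shows "\<bar>birkhoff \<psi> n m\<bar> \<le> real n * B"
proof -
  have "\<bar>birkhoff \<psi> n m\<bar> \<le> (\<Sum>k<n. \<bar>\<psi> (br ((T ^^ k) m)) (snd ((T ^^ k) m))\<bar>)"
    unfolding birkhoff_def by (rule sum_abs)
  also have "\<dots> \<le> (\<Sum>k<n. B)"
    by (intro sum_mono current_bounded[where \<psi>=\<psi>, OF B T_funpow_space[OF m]])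
  finally show ?thesis by simp
qed

lemma power2_bounded: "\<bar>x\<bar> \<le> B \<Longrightarrow> \<bar>x\<^sup>2\<bar> \<le> (B::real)\<^sup>2"
  using power_mono[of "\<bar>x\<bar>" B 2] by simp

lemma integrable_birkhoff_square:
  assumes [measurable]: "\<And>i. \<psi> i \<in> borel_measurable P"
    and B: "\<And>i \<omega>. i \<in> {1..N} \<Longrightarrow> \<omega> \<in> space P \<Longrightarrow> \<bar>\<psi> i \<omega>\<bar> \<le> B"
  shows "integrable \<mu> (\<lambda>m. (birkhoff \<psi> n m)\<^sup>2)"
  using power2_bounded[OF birkhoff_bounded[where \<psi>=\<psi>, OF B]]
  by (intro integrable_pvp[where B="(real n * B)\<^sup>2"]) auto

text \<open>The hypothesis \<open>zero\<close> says that \<open>\<psi>\<close> is a martingale difference; the mean of the sum vanishes in every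
  environment, by induction through the first step.\<close>
lemma martingale_mean_zero:
  assumes \<psi>[measurable]: "\<And>i. \<psi> i \<in> borel_measurable P"
    and B: "\<And>i \<omega>. i \<in> {1..N} \<Longrightarrow> \<omega> \<in> space P \<Longrightarrow> \<bar>\<psi> i \<omega>\<bar> \<le> B"
    and zero: "\<And>\<omega>. \<omega> \<in> space P \<Longrightarrow> (\<Sum>i=1..N. q i \<omega> * \<psi> i \<omega>) = 0"
    and \<omega>: "\<omega> \<in> space P"
  shows "(\<integral>s. birkhoff \<psi> n (s, \<omega>) \<partial>unit_lebesgue) = 0"
  using \<omega>
proof (induction n arbitrary: \<omega>)
  case (Suc n)
  note \<omega> = Suc.prems
  have SB: "\<bar>birkhoff \<psi> n m\<bar> \<le> real n * B" if "m \<in> space \<mu>" for m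
    using birkhoff_bounded[where \<psi>=\<psi>, OF B that] .
  have int: "integrable unit_lebesgue (\<lambda>s. birkhoff \<psi> n (s, \<tau> z \<omega>))" for z
    using SB \<omega> by (intro integrable_section[where B="real n * B"]) auto
  define G where "G i m = \<psi> i \<omega> + birkhoff \<psi> n m" for i m
  have "(\<integral>s. birkhoff \<psi> (Suc n) (s, \<omega>) \<partial>unit_lebesgue) =
      (\<integral>s. G (br (s, \<omega>)) (T (s, \<omega>)) \<partial>unit_lebesgue)"
    by (simp add: birkhoff_Suc G_def)
  also have "\<dots> = (\<Sum>i=1..N. q i \<omega> *\<^sub>R (\<integral>s. G i (s, \<tau> (d i) \<omega>) \<partial>unit_lebesgue))"
  proof (rule first_step_quenched[OF \<omega>, where B="B + real n * B"])
    fix i m assume "i \<in> {1..N}" "m \<in> space \<mu>"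
    then show "norm (G i m) \<le> B + real n * B"
      using B[of i \<omega>] SB[of m] \<omega> unfolding G_def real_norm_def by linarith
  qed (simp add: G_def)
  also have "\<dots> = (\<Sum>i=1..N. q i \<omega> * \<psi> i \<omega>)"
    using int Suc.IH[OF tau_space[OF \<omega>]] by (simp add: G_def unit.prob_space space_restrict_space)
  finally show ?case using zero[OF \<omega>] by simp
qed simp

text \<open>Orthogonality of martingale differences, with the first one split off instead of the last: given
  the first step, the remaining sum has mean zero, so the cross term disappears, and stationarity
  returns the remaining square to the induction hypothesis.\<close>
lemma martingale_second_moment:
  assumes \<psi>[measurable]: "\<And>i. \<psi> i \<in> borel_measurable P"
    and B: "\<And>i \<omega>. i \<in> {1..N} \<Longrightarrow> \<omega> \<in> space P \<Longrightarrow> \<bar>\<psi> i \<omega>\<bar> \<le> B"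
    and zero: "\<And>\<omega>. \<omega> \<in> space P \<Longrightarrow> (\<Sum>i=1..N. q i \<omega> * \<psi> i \<omega>) = 0"
  shows "(\<integral>m. (birkhoff \<psi> n m)\<^sup>2 \<partial>\<mu>) = real n * (\<integral>m. (\<psi> (br m) (snd m))\<^sup>2 \<partial>\<mu>)"
proof (induction n)
  case (Suc n)
  have SB: "\<bar>birkhoff \<psi> n m\<bar> \<le> real n * B" if "m \<in> space \<mu>" for m
    using birkhoff_bounded[where \<psi>=\<psi>, OF B that] .
  have CB: "\<bar>\<psi> (br m) (snd m)\<bar> \<le> B" if "m \<in> space \<mu>" for m
    using current_bounded[where \<psi>=\<psi>, OF B that] .
  have [measurable]: "(\<lambda>m. birkhoff \<psi> n (T m)) \<in> borel_measurable \<mu>"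
    by (rule measurable_compose[OF T_measurable]) measurable
  have prodB: "\<bar>\<psi> (br m) (snd m) * birkhoff \<psi> n (T m)\<bar> \<le> B * (real n * B)" if "m \<in> space \<mu>" for m
    unfolding abs_mult using CB[OF that] SB[OF T_space[OF that]]
    by (intro mult_mono) auto
  have i1: "integrable \<mu> (\<lambda>m. (\<psi> (br m) (snd m))\<^sup>2)"
    using power2_bounded[OF CB] by (intro integrable_pvp[where B="B\<^sup>2"]) auto
  have i2: "integrable \<mu> (\<lambda>m. \<psi> (br m) (snd m) * birkhoff \<psi> n (T m))"
    using prodB by (intro integrable_pvp[where B="B * (real n * B)"]) auto
  have i3: "integrable \<mu> (\<lambda>m. (birkhoff \<psi> n (T m))\<^sup>2)"
    using power2_bounded[OF SB[OF T_space]] by (intro integrable_pvp[where B="(real n * B)\<^sup>2"]) auto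
  have cross: "(\<integral>m. \<psi> (br m) (snd m) * birkhoff \<psi> n (T m) \<partial>\<mu>) = 0"
  proof -
    have "(\<integral>s. \<psi> (br (s, \<omega>)) \<omega> * birkhoff \<psi> n (T (s, \<omega>)) \<partial>unit_lebesgue) = 0"
      if \<omega>: "\<omega> \<in> space P" for \<omega>
    proof -
      define G where "G i m = \<psi> i \<omega> * birkhoff \<psi> n m" for i m
      have "(\<integral>s. G (br (s, \<omega>)) (T (s, \<omega>)) \<partial>unit_lebesgue) =
          (\<Sum>i=1..N. q i \<omega> *\<^sub>R (\<integral>s. G i (s, \<tau> (d i) \<omega>) \<partial>unit_lebesgue))"
      proof (rule first_step_quenched[OF \<omega>, where B="B * (real n * B)"])
        fix i m assume im: "i \<in> {1..N}" "m \<in> space \<mu>"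
        have "0 \<le> B" using B[OF im(1) \<omega>] by linarith
        then show "norm (G i m) \<le> B * (real n * B)"
          using B[OF im(1) \<omega>] SB[OF im(2)] unfolding G_def real_norm_def abs_mult
          by (intro mult_mono) auto
      qed (simp add: G_def)
      also have "\<dots> = 0"
        using martingale_mean_zero[OF \<psi> B zero tau_space[OF \<omega>], of n]
        by (simp add: G_def)
      finally show ?thesis by (simp add: G_def)
    qed
    then have "(\<integral>\<omega>. (\<integral>s. \<psi> (br (s, \<omega>)) (snd (s, \<omega>)) * birkhoff \<psi> n (T (s, \<omega>)) \<partial>unit_lebesgue) \<partial>P) = 0"
      by (subst Bochner_Integration.integral_cong[where g="\<lambda>_. 0" and N=P]) auto
    then show ?thesis using integral_pvp[OF i2] by simp
  qed
  have "(\<integral>m. (birkhoff \<psi> (Suc n) m)\<^sup>2 \<partial>\<mu>) =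
      (\<integral>m. (\<psi> (br m) (snd m))\<^sup>2 + 2 * (\<psi> (br m) (snd m) * birkhoff \<psi> n (T m)) +
        (birkhoff \<psi> n (T m))\<^sup>2 \<partial>\<mu>)"
    by (simp add: birkhoff_Suc power2_sum algebra_simps)
  also have "\<dots> = (\<integral>m. (\<psi> (br m) (snd m))\<^sup>2 \<partial>\<mu>) + (\<integral>m. (birkhoff \<psi> n (T m))\<^sup>2 \<partial>\<mu>)"
    using i1 i2 i3 cross by simp
  also have "(\<integral>m. (birkhoff \<psi> n (T m))\<^sup>2 \<partial>\<mu>) = (\<integral>m. (birkhoff \<psi> n m)\<^sup>2 \<partial>\<mu>)"
    using power2_bounded[OF SB] by (intro integral_T[of "\<lambda>m. (birkhoff \<psi> n m)\<^sup>2" "(real n * B)\<^sup>2"]) auto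
  finally show ?case using Suc.IH by (simp add: algebra_simps)
qed simp

definition mean_square :: "('w \<Rightarrow> real) \<Rightarrow> nat \<Rightarrow> real" where
  "mean_square g n = (\<integral>m. (birkhoff (\<lambda>_. g) n m)\<^sup>2 \<partial>\<mu>) / (real n)\<^sup>2"

lemma mean_square_nonneg: "0 \<le> mean_square g n"
  by (simp add: mean_square_def)

lemma mean_square_tendsto_zeroI:
  assumes "\<And>n. mean_square g n \<le> a n" "a \<longlonglongrightarrow> 0"
  shows "mean_square g \<longlonglongrightarrow> 0"
  by (rule tendsto_sandwich[OF always_eventually always_eventually tendsto_const assms(2)])
     (simp_all add: mean_square_nonneg assms(1))

lemma birkhoff_add: "birkhoff (\<lambda>i \<omega>. \<psi> i \<omega> + \<xi> i \<omega>) n m = birkhoff \<psi> n m + birkhoff \<xi> n m"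
  by (simp add: birkhoff_def sum.distrib)

lemma birkhoff_scale: "birkhoff (\<lambda>i \<omega>. c * \<psi> i \<omega>) n m = c * birkhoff \<psi> n m"
  by (simp add: birkhoff_def sum_distrib_left)

lemma square_sum_le: "(x + y)\<^sup>2 \<le> 2 * x\<^sup>2 + 2 * (y::real)\<^sup>2"
  using zero_le_power2[of "x - y"] by (simp add: power2_sum power2_diff)

lemma mean_square_add_le:
  assumes [measurable]: "f \<in> borel_measurable P" "g \<in> borel_measurable P"
    and B: "\<And>\<omega>. \<omega> \<in> space P \<Longrightarrow> \<bar>f \<omega>\<bar> \<le> B" "\<And>\<omega>. \<omega> \<in> space P \<Longrightarrow> \<bar>g \<omega>\<bar> \<le> B"
  shows "mean_square (\<lambda>\<omega>. f \<omega> + g \<omega>) n \<le> 2 * mean_square f n + 2 * mean_square g n"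
proof -
  have i: "integrable \<mu> (\<lambda>m. (birkhoff (\<lambda>_. f) n m)\<^sup>2)" "integrable \<mu> (\<lambda>m. (birkhoff (\<lambda>_. g) n m)\<^sup>2)"
    using B by (auto intro!: integrable_birkhoff_square[where B=B])
  have "\<bar>f \<omega> + g \<omega>\<bar> \<le> B + B" if "\<omega> \<in> space P" for \<omega>
    using B[OF that] by linarith
  then have "integrable \<mu> (\<lambda>m. (birkhoff (\<lambda>_ \<omega>. f \<omega> + g \<omega>) n m)\<^sup>2)"
    by (intro integrable_birkhoff_square[where B="B + B"]) auto
  then have "(\<integral>m. (birkhoff (\<lambda>_ \<omega>. f \<omega> + g \<omega>) n m)\<^sup>2 \<partial>\<mu>) \<le>
      (\<integral>m. 2 * (birkhoff (\<lambda>_. f) n m)\<^sup>2 + 2 * (birkhoff (\<lambda>_. g) n m)\<^sup>2 \<partial>\<mu>)"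
    using i by (intro integral_mono) (auto simp: birkhoff_add square_sum_le)
  also have "\<dots> = 2 * (\<integral>m. (birkhoff (\<lambda>_. f) n m)\<^sup>2 \<partial>\<mu>) + 2 * (\<integral>m. (birkhoff (\<lambda>_. g) n m)\<^sup>2 \<partial>\<mu>)"
    using i by simp
  finally have "(\<integral>m. (birkhoff (\<lambda>_ \<omega>. f \<omega> + g \<omega>) n m)\<^sup>2 \<partial>\<mu>) / (real n)\<^sup>2 \<le> \<dots> / (real n)\<^sup>2"
    by (rule divide_right_mono) simp
  then show ?thesis by (simp add: mean_square_def add_divide_distrib)
qed

lemma mean_square_scale: "mean_square (\<lambda>\<omega>. c * f \<omega>) n = c\<^sup>2 * mean_square f n"
  by (simp add: mean_square_def birkhoff_scale power_mult_distrib)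

lemma mean_square_le_norm:
  assumes [measurable]: "g \<in> borel_measurable P"
    and B: "\<And>\<omega>. \<omega> \<in> space P \<Longrightarrow> \<bar>g \<omega>\<bar> \<le> B"
  shows "mean_square g n \<le> (\<integral>\<omega>. (g \<omega>)\<^sup>2 \<partial>P)"
proof -
  have g2: "\<bar>(g (snd m))\<^sup>2\<bar> \<le> B\<^sup>2" if "m \<in> space \<mu>" for m
    using power2_bounded[OF B, of "snd m"] that by (auto simp: space_pvp)
  have i: "integrable \<mu> (\<lambda>m. (g (snd ((T ^^ k) m)))\<^sup>2)" for k
    using g2[OF T_funpow_space] measurable_compose[OF T_funpow_measurable, of "\<lambda>m. (g (snd m))\<^sup>2"]
    by (intro integrable_pvp[where B="B\<^sup>2"]) auto
  have stationary: "(\<integral>m. (g (snd ((T ^^ k) m)))\<^sup>2 \<partial>\<mu>) = (\<integral>\<omega>. (g \<omega>)\<^sup>2 \<partial>P)" for k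
    using integral_T_funpow[of "\<lambda>m. (g (snd m))\<^sup>2" "B\<^sup>2" k] g2
      integral_environment[of "\<lambda>\<omega>. (g \<omega>)\<^sup>2" "B\<^sup>2"] power2_bounded[OF B] by simp
  have "(\<integral>m. (birkhoff (\<lambda>_. g) n m)\<^sup>2 \<partial>\<mu>) \<le>
      (\<integral>m. (\<Sum>k<n. (g (snd ((T ^^ k) m)))\<^sup>2) * real n \<partial>\<mu>)"
  proof (intro integral_mono)
    show "integrable \<mu> (\<lambda>m. (birkhoff (\<lambda>_. g) n m)\<^sup>2)"
      using B by (auto intro!: integrable_birkhoff_square[where B=B])
    show "integrable \<mu> (\<lambda>m. (\<Sum>k<n. (g (snd ((T ^^ k) m)))\<^sup>2) * real n)"
      using i by simp
    show "(birkhoff (\<lambda>_. g) n m)\<^sup>2 \<le> (\<Sum>k<n. (g (snd ((T ^^ k) m)))\<^sup>2) * real n" for m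
      unfolding birkhoff_def
      using sum_squared_le_sum_of_squares[of "\<lambda>k. g (snd ((T ^^ k) m))" "{..<n}"] by simp
  qed
  also have "\<dots> = (\<Sum>k<n. \<integral>m. (g (snd ((T ^^ k) m)))\<^sup>2 \<partial>\<mu>) * real n"
    using i by (simp add: Bochner_Integration.integral_sum)
  also have "\<dots> = (\<integral>\<omega>. (g \<omega>)\<^sup>2 \<partial>P) * (real n)\<^sup>2"
    unfolding stationary by (simp add: power2_eq_square)
  finally show ?thesis
    by (cases "n = 0") (auto simp: mean_square_def divide_le_eq)
qed

text \<open>Up to two boundary terms, the sum of \<open>g(\<omega>\<^sub>k) - markov g (\<omega>\<^sub>k)\<close> is that of the martingale differences
  \<open>g(\<omega>\<^sub>k\<^sub>+\<^sub>1) - markov g (\<omega>\<^sub>k)\<close>, whose second moment grows only linearly.\<close>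
lemma mean_square_coboundary:
  assumes g[measurable]: "g \<in> borel_measurable P"
    and B: "\<And>\<omega>. \<omega> \<in> space P \<Longrightarrow> \<bar>g \<omega>\<bar> \<le> B"
  shows "mean_square (\<lambda>\<omega>. g \<omega> - markov g \<omega>) \<longlonglongrightarrow> 0"
proof -
  define \<psi> where "\<psi> i \<omega> = g (\<tau> (d i) \<omega>) - markov g \<omega>" for i \<omega>
  have \<psi>[measurable]: "\<psi> i \<in> borel_measurable P" for i
    unfolding \<psi>_def[abs_def] by measurable
  have \<psi>B: "\<bar>\<psi> i \<omega>\<bar> \<le> 2 * B" if "i \<in> {1..N}" "\<omega> \<in> space P" for i \<omega>
    using B[OF tau_space[OF that(2)], of "d i"] markov_bounded[where g=g, OF B that(2)]
    unfolding \<psi>_def by linarith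
  have \<psi>0: "(\<Sum>i=1..N. q i \<omega> * \<psi> i \<omega>) = 0" if "\<omega> \<in> space P" for \<omega>
    using sum_q[OF that]
    by (simp add: \<psi>_def markov_def right_diff_distrib sum_subtractf flip: sum_distrib_right del: One_nat_def)
  have decomp: "birkhoff (\<lambda>_ \<omega>. g \<omega> - markov g \<omega>) n m = (g (snd m) - g (snd ((T ^^ n) m))) + birkhoff \<psi> n m"
    for n m
  proof (induction n)
    case (Suc n)
    then show ?case by (simp add: birkhoff_def \<psi>_def snd_T)
  qed simp
  have "mean_square (\<lambda>\<omega>. g \<omega> - markov g \<omega>) n \<le> (8 * B\<^sup>2 + 8 * B\<^sup>2 * real n) / (real n)\<^sup>2" for n
  proof -
    have i: "integrable \<mu> (\<lambda>m. (birkhoff \<psi> n m)\<^sup>2)"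
      using \<psi>B by (intro integrable_birkhoff_square[where B="2 * B"]) auto
    have "(\<integral>m. (birkhoff (\<lambda>_ \<omega>. g \<omega> - markov g \<omega>) n m)\<^sup>2 \<partial>\<mu>) \<le>
        (\<integral>m. 2 * (2 * B)\<^sup>2 + 2 * (birkhoff \<psi> n m)\<^sup>2 \<partial>\<mu>)"
    proof (intro integral_mono)
      have "\<bar>g \<omega> - markov g \<omega>\<bar> \<le> 2 * B" if "\<omega> \<in> space P" for \<omega>
        using B[OF that] markov_bounded[where g=g, OF B that] by linarith
      then show "integrable \<mu> (\<lambda>m. (birkhoff (\<lambda>_ \<omega>. g \<omega> - markov g \<omega>) n m)\<^sup>2)"
        by (intro integrable_birkhoff_square[where B="2 * B"]) auto
      show "integrable \<mu> (\<lambda>m. 2 * (2 * B)\<^sup>2 + 2 * (birkhoff \<psi> n m)\<^sup>2)" using i by simp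
      fix m assume m: "m \<in> space \<mu>"
      have "snd m \<in> space P" "snd ((T ^^ n) m) \<in> space P"
        using m T_funpow_space[OF m, of n] by (auto simp: space_pvp mem_Times_iff)
      then have "\<bar>g (snd m) - g (snd ((T ^^ n) m))\<bar> \<le> 2 * B"
        using B[of "snd m"] B[of "snd ((T ^^ n) m)"] by linarith
      from power2_bounded[OF this]
      show "(birkhoff (\<lambda>_ \<omega>. g \<omega> - markov g \<omega>) n m)\<^sup>2 \<le> 2 * (2 * B)\<^sup>2 + 2 * (birkhoff \<psi> n m)\<^sup>2"
        unfolding decomp using square_sum_le[of "g (snd m) - g (snd ((T ^^ n) m))" "birkhoff \<psi> n m"]
        by linarith
    qed
    also have "\<dots> = 2 * (2 * B)\<^sup>2 + 2 * (\<integral>m. (birkhoff \<psi> n m)\<^sup>2 \<partial>\<mu>)"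
      using i by (simp add: skew.prob_space)
    finally have 1: "(\<integral>m. (birkhoff (\<lambda>_ \<omega>. g \<omega> - markov g \<omega>) n m)\<^sup>2 \<partial>\<mu>) \<le>
        2 * (2 * B)\<^sup>2 + 2 * (\<integral>m. (birkhoff \<psi> n m)\<^sup>2 \<partial>\<mu>)" .
    have 2: "(\<integral>m. (birkhoff \<psi> n m)\<^sup>2 \<partial>\<mu>) = real n * (\<integral>m. (\<psi> (br m) (snd m))\<^sup>2 \<partial>\<mu>)"
      using \<psi>B \<psi>0 by (intro martingale_second_moment[where B="2 * B"]) auto
    have "(\<integral>m. (\<psi> (br m) (snd m))\<^sup>2 \<partial>\<mu>) \<le> (\<integral>m. (2 * B)\<^sup>2 \<partial>\<mu>)"
    proof (intro integral_mono)
      have b: "\<bar>(\<psi> (br m) (snd m))\<^sup>2\<bar> \<le> (2 * B)\<^sup>2" if "m \<in> space \<mu>" for m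
        using power2_bounded[OF current_bounded[where \<psi>=\<psi>, OF \<psi>B that]] .
      then show "integrable \<mu> (\<lambda>m. (\<psi> (br m) (snd m))\<^sup>2)"
        by (intro integrable_pvp[where B="(2 * B)\<^sup>2"]) auto
      show "(\<psi> (br m) (snd m))\<^sup>2 \<le> (2 * B)\<^sup>2" if "m \<in> space \<mu>" for m
        using b[OF that] by simp
    qed simp
    then have 3: "(\<integral>m. (\<psi> (br m) (snd m))\<^sup>2 \<partial>\<mu>) \<le> (2 * B)\<^sup>2" by (simp add: skew.prob_space)
    have "(\<integral>m. (birkhoff (\<lambda>_ \<omega>. g \<omega> - markov g \<omega>) n m)\<^sup>2 \<partial>\<mu>) \<le> 8 * B\<^sup>2 + 8 * B\<^sup>2 * real n"
      using 1 mult_left_mono[OF 3, of "real n"] unfolding 2 by (simp add: power_mult_distrib mult_ac)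
    then show ?thesis unfolding mean_square_def by (intro divide_right_mono) auto
  qed
  moreover have "(\<lambda>n. (8 * B\<^sup>2 + 8 * B\<^sup>2 * real n) / (real n)\<^sup>2) \<longlonglongrightarrow> 0"
  proof -
    have "(\<lambda>n. 8 * B\<^sup>2 * (inverse (real n) * inverse (real n)) + 8 * B\<^sup>2 * inverse (real n))
        \<longlonglongrightarrow> 8 * B\<^sup>2 * (0 * 0) + 8 * B\<^sup>2 * 0"
      by (intro tendsto_intros lim_inverse_n)
    moreover have "8 * B\<^sup>2 * (inverse (real n) * inverse (real n)) + 8 * B\<^sup>2 * inverse (real n) =
        (8 * B\<^sup>2 + 8 * B\<^sup>2 * real n) / (real n)\<^sup>2" for n
      by (cases "n = 0") (auto simp: field_simps power2_eq_square)
    ultimately show ?thesis by simp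
  qed
  ultimately show ?thesis by (rule mean_square_tendsto_zeroI)
qed

text \<open>The set \<open>K\<close> consists of the centred functions whose averages along the walk are asymptotically those of
  \<open>h\<close>. It contains \<open>h\<close> and is closed under the transition operator (up to a coboundary) and under
  midpoints, so it has elements of arbitrarily small norm; and the mean square of the averages of such an
  element is bounded by its squared norm, whatever the number of steps.\<close>
theorem L2_ergodic_theorem:
  assumes h[measurable]: "h \<in> borel_measurable P"
    and B: "\<And>\<omega>. \<omega> \<in> space P \<Longrightarrow> \<bar>h \<omega>\<bar> \<le> B"
    and mean: "(\<integral>\<omega>. h \<omega> \<partial>P) = 0"
  shows "mean_square h \<longlonglongrightarrow> 0"
proof -
  define K where "K = {g. g \<in> borel_measurable P \<and> (\<forall>\<omega>\<in>space P. \<bar>g \<omega>\<bar> \<le> B) \<and>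
    (\<integral>\<omega>. g \<omega> \<partial>P) = 0 \<and> mean_square (\<lambda>\<omega>. h \<omega> - g \<omega>) \<longlonglongrightarrow> 0}"
  have diff_bound: "\<bar>f \<omega> - g \<omega>\<bar> \<le> 2 * B"
    if "\<forall>\<omega>\<in>space P. \<bar>f \<omega>\<bar> \<le> B" "\<forall>\<omega>\<in>space P. \<bar>g \<omega>\<bar> \<le> B" "\<omega> \<in> space P" for f g :: "'w \<Rightarrow> real" and \<omega>
    using that(1)[rule_format, OF that(3)] that(2)[rule_format, OF that(3)] by linarith
  have hB: "\<forall>\<omega>\<in>space P. \<bar>h \<omega>\<bar> \<le> B" using B by blast
  have hK: "h \<in> K"
  proof -
    have "mean_square (\<lambda>\<omega>. 0) = (\<lambda>_. 0)"
      by (simp add: fun_eq_iff mean_square_def birkhoff_def)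
    then show ?thesis using B mean by (simp add: K_def)
  qed
  have markovK: "markov g \<in> K" if "g \<in> K" for g
  proof -
    have g[measurable]: "g \<in> borel_measurable P" and gB: "\<forall>\<omega>\<in>space P. \<bar>g \<omega>\<bar> \<le> B"
      and g0: "(\<integral>\<omega>. g \<omega> \<partial>P) = 0" and lim: "mean_square (\<lambda>\<omega>. h \<omega> - g \<omega>) \<longlonglongrightarrow> 0"
      using that by (auto simp: K_def)
    have mB: "\<forall>\<omega>\<in>space P. \<bar>markov g \<omega>\<bar> \<le> B" using markov_bounded[where g=g and B=B] gB by blast
    have "mean_square (\<lambda>\<omega>. h \<omega> - markov g \<omega>) n \<le>
        2 * mean_square (\<lambda>\<omega>. h \<omega> - g \<omega>) n + 2 * mean_square (\<lambda>\<omega>. g \<omega> - markov g \<omega>) n" for n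
      using mean_square_add_le[of "\<lambda>\<omega>. h \<omega> - g \<omega>" "\<lambda>\<omega>. g \<omega> - markov g \<omega>" "2 * B" n]
        diff_bound[OF hB gB] diff_bound[OF gB mB] by simp
    moreover have "(\<lambda>n. 2 * mean_square (\<lambda>\<omega>. h \<omega> - g \<omega>) n + 2 * mean_square (\<lambda>\<omega>. g \<omega> - markov g \<omega>) n) \<longlonglongrightarrow> 2 * 0 + 2 * 0"
      using mean_square_coboundary[OF g, of B] gB by (intro tendsto_intros lim) auto
    ultimately have "mean_square (\<lambda>\<omega>. h \<omega> - markov g \<omega>) \<longlonglongrightarrow> 0"
      using mean_square_tendsto_zeroI by (metis (no_types, lifting) add_0 mult_zero_right)
    then show ?thesis using mB g0 integral_markov[OF g, of B] gB by (simp add: K_def)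
  qed
  have midK: "(\<lambda>\<omega>. (f \<omega> + g \<omega>) / 2) \<in> K" if fK: "f \<in> K" and gK: "g \<in> K" for f g
  proof -
    have [measurable]: "f \<in> borel_measurable P" "g \<in> borel_measurable P"
      and fgB: "\<forall>\<omega>\<in>space P. \<bar>f \<omega>\<bar> \<le> B" "\<forall>\<omega>\<in>space P. \<bar>g \<omega>\<bar> \<le> B"
      and fg0: "(\<integral>\<omega>. f \<omega> \<partial>P) = 0" "(\<integral>\<omega>. g \<omega> \<partial>P) = 0"
      and lim: "mean_square (\<lambda>\<omega>. h \<omega> - f \<omega>) \<longlonglongrightarrow> 0" "mean_square (\<lambda>\<omega>. h \<omega> - g \<omega>) \<longlonglongrightarrow> 0"
      using fK gK by (auto simp: K_def)
    have "mean_square (\<lambda>\<omega>. h \<omega> - (f \<omega> + g \<omega>) / 2) n \<le>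
        mean_square (\<lambda>\<omega>. h \<omega> - f \<omega>) n + mean_square (\<lambda>\<omega>. h \<omega> - g \<omega>) n" for n
    proof -
      have eq: "(\<lambda>\<omega>. h \<omega> - (f \<omega> + g \<omega>) / 2) = (\<lambda>\<omega>. 1/2 * ((h \<omega> - f \<omega>) + (h \<omega> - g \<omega>)))"
        by (auto simp: field_simps)
      show ?thesis
        unfolding eq mean_square_scale
        using mean_square_add_le[of "\<lambda>\<omega>. h \<omega> - f \<omega>" "\<lambda>\<omega>. h \<omega> - g \<omega>" "2 * B" n]
          diff_bound[OF hB fgB(1)] diff_bound[OF hB fgB(2)]
          mean_square_nonneg[of "\<lambda>\<omega>. h \<omega> - f \<omega>" n] mean_square_nonneg[of "\<lambda>\<omega>. h \<omega> - g \<omega>" n]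
        by (simp add: power_divide)
    qed
    moreover have "(\<lambda>n. mean_square (\<lambda>\<omega>. h \<omega> - f \<omega>) n + mean_square (\<lambda>\<omega>. h \<omega> - g \<omega>) n) \<longlonglongrightarrow> 0 + 0"
      by (intro tendsto_add lim)
    ultimately have "mean_square (\<lambda>\<omega>. h \<omega> - (f \<omega> + g \<omega>) / 2) \<longlonglongrightarrow> 0"
      using mean_square_tendsto_zeroI by (metis (no_types, lifting) add_0 mult_zero_right)
    moreover have "\<bar>(f \<omega> + g \<omega>) / 2\<bar> \<le> B" if "\<omega> \<in> space P" for \<omega>
      using fgB that by (force simp: abs_le_iff)
    moreover have "(\<integral>\<omega>. (f \<omega> + g \<omega>) / 2 \<partial>P) = 0"
      using fg0 fgB integrable_bounded[of f B] integrable_bounded[of g B] by simp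
    ultimately show ?thesis by (simp add: K_def)
  qed
  show ?thesis
  proof (rule LIMSEQ_I)
    fix r :: real assume r: "0 < r"
    have "g \<in> borel_measurable P \<and> (\<integral>\<omega>. g \<omega> \<partial>P) = 0" if "g \<in> K" for g
      using that by (simp add: K_def)
    moreover have "\<bar>g \<omega>\<bar> \<le> B" if "g \<in> K" "\<omega> \<in> space P" for g \<omega>
      using that by (simp add: K_def)
    ultimately have "\<exists>g\<in>K. (\<integral>\<omega>. (g \<omega>)\<^sup>2 \<partial>P) < r / 4"
      using r by (intro hull_small_norm[OF hK, where B=B] markovK midK) simp_all
    then obtain g where gK: "g \<in> K" and small: "(\<integral>\<omega>. (g \<omega>)\<^sup>2 \<partial>P) < r / 4"
      by blast
    have [measurable]: "g \<in> borel_measurable P" and gB: "\<forall>\<omega>\<in>space P. \<bar>g \<omega>\<bar> \<le> B"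
      and lim: "mean_square (\<lambda>\<omega>. h \<omega> - g \<omega>) \<longlonglongrightarrow> 0"
      using gK by (auto simp: K_def)
    obtain n0 where n0: "\<And>n. n0 \<le> n \<Longrightarrow> mean_square (\<lambda>\<omega>. h \<omega> - g \<omega>) n < r / 4"
    proof -
      have "eventually (\<lambda>n. mean_square (\<lambda>\<omega>. h \<omega> - g \<omega>) n < r / 4) sequentially"
        using lim r by (intro order_tendstoD(2)) auto
      then show ?thesis using that by (auto simp: eventually_sequentially)
    qed
    have "norm (mean_square h n - 0) < r" if "n0 \<le> n" for n
    proof -
      have "0 \<le> 2 * B" using diff_bound[OF hB hB] not_empty by fastforce
      then have "\<bar>g \<omega>\<bar> \<le> 2 * B" if "\<omega> \<in> space P" for \<omega> using gB[rule_format, OF that] by linarith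
      then have "mean_square h n \<le> 2 * mean_square (\<lambda>\<omega>. h \<omega> - g \<omega>) n + 2 * mean_square g n"
        using mean_square_add_le[of "\<lambda>\<omega>. h \<omega> - g \<omega>" g "2 * B" n] diff_bound[OF hB gB] by simp
      moreover have "mean_square g n \<le> (\<integral>\<omega>. (g \<omega>)\<^sup>2 \<partial>P)"
        using gB by (intro mean_square_le_norm[where B=B]) auto
      ultimately show ?thesis using n0[OF that] small mean_square_nonneg[of h n] by simp
    qed
    then show "\<exists>n0. \<forall>n\<ge>n0. norm (mean_square h n - 0) < r" by blast
  qed
qed

end

section \<open>The central limit theorem\<close>

text \<open>The second-order bound behind the compensation of a conditional variance by an exponential factor.\<close>
lemma exp_times_one_minus:
  fixes y :: real
  assumes "0 \<le> y"
  shows "\<bar>exp y * (1 - y) - 1\<bar> \<le> exp y * y\<^sup>2"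
proof -
  have "1 - y \<le> exp (- y)" using exp_ge_add_one_self[of "- y"] by simp
  then have "exp y * (1 - y) \<le> 1" using mult_left_mono[of "1 - y" "exp (- y)" "exp y"]
    by (simp add: exp_minus)
  moreover have "1 - exp y * (1 - y) \<le> exp y * y\<^sup>2"
  proof -
    have "(1 - y + y\<^sup>2) * (1 + y) = 1 + y ^ 3" by (simp add: power2_eq_square power3_eq_cube algebra_simps)
    then have "1 \<le> (1 - y + y\<^sup>2) * (1 + y)" using assms by simp
    also have "\<dots> \<le> (1 - y + y\<^sup>2) * exp y"
    proof (rule mult_left_mono)
      have "0 \<le> (1 - y)\<^sup>2 + y" using assms by simp
      then show "0 \<le> 1 - y + y\<^sup>2" by (simp add: power2_diff)
    qed (rule exp_ge_add_one_self)
    finally show ?thesis by (simp add: algebra_simps)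
  qed
  ultimately show ?thesis by linarith
qed

context particle_view
begin

definition step_variance :: "(nat \<Rightarrow> real) \<Rightarrow> 'w \<Rightarrow> real" where
  "step_variance x \<omega> = (\<Sum>i=1..N. q i \<omega> * (x i)\<^sup>2)"

lemma step_variance_measurable [measurable]: "step_variance x \<in> borel_measurable P"
  unfolding step_variance_def[abs_def] by measurable

lemma step_variance_nonneg: "\<omega> \<in> space P \<Longrightarrow> 0 \<le> step_variance x \<omega>"
  unfolding step_variance_def by (intro sum_nonneg) (auto simp: q_nonneg)

lemma step_variance_le:
  assumes "\<omega> \<in> space P" "\<And>i. i \<in> {1..N} \<Longrightarrow> \<bar>x i\<bar> \<le> b"
  shows "step_variance x \<omega> \<le> b\<^sup>2"
  unfolding step_variance_def using assms power2_bounded by (intro q_average_le) fastforce+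

text \<open>A second-order expansion: the zero drift removes the linear term, and the quadratic term is cancelled
  by the exponential of the conditional variance, which leaves an error of third order in \<open>\<theta>\<close>.\<close>
lemma one_step_characteristic:
  assumes \<omega>: "\<omega> \<in> space P" and xb: "\<And>i. i \<in> {1..N} \<Longrightarrow> \<bar>x i\<bar> \<le> b"
    and drift: "(\<Sum>i=1..N. q i \<omega> * x i) = 0" and \<theta>: "0 \<le> \<theta>" "\<theta> \<le> 1"
  shows "cmod ((\<Sum>i=1..N. q i \<omega> *\<^sub>R exp (\<i> * (\<theta> * x i) + \<theta>\<^sup>2 * step_variance x \<omega> / 2)) - 1)
    \<le> exp (b\<^sup>2 / 2) * (b^4 / 4 + b^3 / 6) * \<theta>^3"
proof -
  define v where "v = step_variance x \<omega>"
  define y where "y = \<theta>\<^sup>2 * v / 2"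
  define R where "R i = iexp (\<theta> * x i) - (\<Sum>k\<le>2. (\<i> * (\<theta> * x i))^k / fact k)" for i
  have v: "0 \<le> v" "v \<le> b\<^sup>2"
    unfolding v_def using \<omega> xb by (auto intro: step_variance_nonneg step_variance_le)
  have \<theta>2: "\<theta>\<^sup>2 \<le> 1" using \<theta> by (simp add: power_le_one)
  have y: "0 \<le> y" "y \<le> \<theta>\<^sup>2 * b\<^sup>2 / 2"
    using v \<theta> by (auto simp: y_def intro!: mult_left_mono)
  have yb: "y \<le> b\<^sup>2 / 2"
    using y(2) mult_right_mono[OF \<theta>2, of "b\<^sup>2"] by simp
  have b: "0 \<le> b \<or> N = 0" using xb[of 1] by force
  have N: "N \<noteq> 0"
  proof
    assume "N = 0"
    then show False using sum_q[OF \<omega>] by simp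
  qed
  have b0: "0 \<le> b" using b N by blast
  have Rb: "cmod (R i) \<le> \<theta>^3 * b^3 / 6" if "i \<in> {1..N}" for i
  proof -
    have "cmod (R i) \<le> \<bar>\<theta> * x i\<bar> ^ Suc 2 / fact (Suc 2)"
      unfolding R_def using iexp_approx1[of "\<theta> * x i" 2] by simp
    also have "\<dots> = \<theta>^3 * \<bar>x i\<bar>^3 / 6"
      using \<theta> by (simp add: abs_mult power_mult_distrib fact_numeral numeral_3_eq_3)
    also have "\<dots> \<le> \<theta>^3 * b^3 / 6"
      using xb[OF that] \<theta> by (intro divide_right_mono mult_left_mono power_mono) auto
    finally show ?thesis .
  qed
  have taylor: "iexp (\<theta> * x i) = 1 + \<i> * \<theta> * x i - of_real (\<theta>\<^sup>2 * (x i)\<^sup>2 / 2) + R i" for i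
    by (simp add: R_def numeral_2_eq_2 power_mult_distrib)
  have "(\<Sum>i=1..N. q i \<omega> *\<^sub>R iexp (\<theta> * x i)) =
      of_real (\<Sum>i=1..N. q i \<omega>) + \<i> * \<theta> * of_real (\<Sum>i=1..N. q i \<omega> * x i)
      - of_real (\<theta>\<^sup>2 / 2 * (\<Sum>i=1..N. q i \<omega> * (x i)\<^sup>2)) + (\<Sum>i=1..N. q i \<omega> *\<^sub>R R i)"
    unfolding taylor
    by (simp add: scaleR_conv_of_real sum.distrib sum_subtractf sum_distrib_left algebra_simps)
  also have "\<dots> = of_real (1 - y) + (\<Sum>i=1..N. q i \<omega> *\<^sub>R R i)"
    unfolding sum_q[OF \<omega>] drift by (simp add: y_def v_def step_variance_def)
  finally have f: "(\<Sum>i=1..N. q i \<omega> *\<^sub>R iexp (\<theta> * x i)) = of_real (1 - y) + (\<Sum>i=1..N. q i \<omega> *\<^sub>R R i)" .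
  have "(\<Sum>i=1..N. q i \<omega> *\<^sub>R exp (\<i> * (\<theta> * x i) + \<theta>\<^sup>2 * v / 2)) =
      of_real (exp y) * (\<Sum>i=1..N. q i \<omega> *\<^sub>R iexp (\<theta> * x i))"
    unfolding sum_distrib_left
    by (intro sum.cong refl) (simp add: exp_add y_def scaleR_conv_of_real exp_of_real[symmetric])
  also have "\<dots> = of_real (exp y * (1 - y)) + of_real (exp y) * (\<Sum>i=1..N. q i \<omega> *\<^sub>R R i)"
    unfolding f by (simp add: distrib_left)
  finally have eq: "(\<Sum>i=1..N. q i \<omega> *\<^sub>R exp (\<i> * (\<theta> * x i) + \<theta>\<^sup>2 * v / 2)) - 1 =
      of_real (exp y * (1 - y) - 1) + of_real (exp y) * (\<Sum>i=1..N. q i \<omega> *\<^sub>R R i)"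
    by simp
  have "cmod ((\<Sum>i=1..N. q i \<omega> *\<^sub>R exp (\<i> * (\<theta> * x i) + \<theta>\<^sup>2 * v / 2)) - 1) \<le>
      \<bar>exp y * (1 - y) - 1\<bar> + exp y * cmod (\<Sum>i=1..N. q i \<omega> *\<^sub>R R i)"
    unfolding eq by (rule order_trans[OF norm_triangle_ineq]) (simp add: norm_mult del: of_real_diff of_real_mult)
  also have "\<dots> \<le> exp y * y\<^sup>2 + exp y * (\<theta>^3 * b^3 / 6)"
  proof (intro add_mono mult_left_mono exp_times_one_minus[OF y(1)])
    have "cmod (\<Sum>i=1..N. q i \<omega> *\<^sub>R R i) \<le> (\<Sum>i=1..N. q i \<omega> * cmod (R i))"
      using q_nonneg[OF \<omega>] by (intro sum_norm_le) simp
    also have "\<dots> \<le> \<theta>^3 * b^3 / 6" by (rule q_average_le[OF \<omega> Rb])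
    finally show "cmod (\<Sum>i=1..N. q i \<omega> *\<^sub>R R i) \<le> \<theta>^3 * b^3 / 6" .
  qed simp
  also have "\<dots> = exp y * (y\<^sup>2 + \<theta>^3 * b^3 / 6)" by (simp add: distrib_left)
  also have "\<dots> \<le> exp (b\<^sup>2 / 2) * (\<theta>^3 * b^4 / 4 + \<theta>^3 * b^3 / 6)"
  proof (intro mult_mono add_right_mono)
    have "y\<^sup>2 \<le> (\<theta>\<^sup>2 * b\<^sup>2 / 2)\<^sup>2" using y by (intro power_mono) auto
    also have "\<dots> = \<theta>^4 * b^4 / 4" by (simp add: power_mult_distrib power_divide flip: power_mult)
    also have "\<dots> \<le> \<theta>^3 * b^4 / 4"
      using \<theta> by (intro divide_right_mono mult_right_mono power_decreasing) auto
    finally show "y\<^sup>2 \<le> \<theta>^3 * b^4 / 4" .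
  qed (use yb \<theta> b0 in auto)
  also have "\<dots> = exp (b\<^sup>2 / 2) * (b^4 / 4 + b^3 / 6) * \<theta>^3" by (simp add: algebra_simps)
  finally show ?thesis by (simp add: v_def)
qed

text \<open>The exponential of the projected walk, divided by the product of the Gaussian approximations of the
  conditional characteristic functions of its steps. Up to third order in \<open>\<theta>\<close> per step it is a
  martingale.\<close>
definition compensated :: "(nat \<Rightarrow> real) \<Rightarrow> real \<Rightarrow> nat \<Rightarrow> real \<times> 'w \<Rightarrow> complex" where
  "compensated x \<theta> n m = exp (\<i> * (\<theta> * birkhoff (\<lambda>i _. x i) n m) +
    \<theta>\<^sup>2 * birkhoff (\<lambda>_. step_variance x) n m / 2)"

lemma compensated_measurable [measurable]: "compensated x \<theta> n \<in> borel_measurable \<mu>"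
  unfolding compensated_def[abs_def] by measurable

lemma norm_compensated: "cmod (compensated x \<theta> n m) = exp (\<theta>\<^sup>2 * birkhoff (\<lambda>_. step_variance x) n m / 2)"
  by (simp add: compensated_def)

lemma compensated_bounded:
  assumes xb: "\<And>i. i \<in> {1..N} \<Longrightarrow> \<bar>x i\<bar> \<le> b" and m: "m \<in> space \<mu>"
  shows "cmod (compensated x \<theta> n m) \<le> exp (\<theta>\<^sup>2 * (real n * b\<^sup>2) / 2)"
proof -
  have "birkhoff (\<lambda>_. step_variance x) n m \<le> real n * b\<^sup>2"
    using birkhoff_bounded[where \<psi>="\<lambda>_. step_variance x" and B="b\<^sup>2" and n=n, OF _ m]
      step_variance_nonneg step_variance_le[OF _ xb] by fastforce
  then show ?thesis by (simp add: norm_compensated mult_left_mono)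
qed

text \<open>Induction through the first step: the error for \<open>n\<close> further steps is multiplied by at most
  \<open>exp (\<theta>\<^sup>2 b\<^sup>2 / 2)\<close>, and the error of one step is added.\<close>
lemma compensated_quenched:
  assumes xb: "\<And>i. i \<in> {1..N} \<Longrightarrow> \<bar>x i\<bar> \<le> b"
    and drift: "\<And>\<omega>. \<omega> \<in> space P \<Longrightarrow> (\<Sum>i=1..N. q i \<omega> * x i) = 0" and \<theta>: "0 \<le> \<theta>" "\<theta> \<le> 1"
    and \<omega>: "\<omega> \<in> space P"
  shows "cmod ((\<integral>s. compensated x \<theta> n (s, \<omega>) \<partial>unit_lebesgue) - 1) \<le>
    real n * (exp (b\<^sup>2 / 2) * (b^4 / 4 + b^3 / 6) * \<theta>^3) * exp (real n * (\<theta>\<^sup>2 * b\<^sup>2 / 2))"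
  using \<omega>
proof (induction n arbitrary: \<omega>)
  case 0
  then show ?case by (simp add: compensated_def)
next
  case (Suc n)
  note \<omega> = Suc.prems
  define K where "K = exp (b\<^sup>2 / 2) * (b^4 / 4 + b^3 / 6) * \<theta>^3"
  define v where "v = step_variance x \<omega>"
  define E where "E = exp (\<theta>\<^sup>2 * b\<^sup>2 / 2)"
  define c where "c i = exp (\<i> * (\<theta> * x i) + \<theta>\<^sup>2 * v / 2)" for i
  define W where "W \<omega> = (\<integral>s. compensated x \<theta> n (s, \<omega>) \<partial>unit_lebesgue)" for \<omega>
  have v: "0 \<le> v" "v \<le> b\<^sup>2"
    unfolding v_def using \<omega> xb by (auto intro: step_variance_nonneg step_variance_le)
  have cE: "cmod (c i) \<le> E" for i
    using v by (simp add: c_def E_def mult_left_mono)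
  have one: "cmod ((\<Sum>i=1..N. q i \<omega> *\<^sub>R c i) - 1) \<le> K"
    unfolding c_def v_def K_def by (rule one_step_characteristic[OF \<omega> xb drift[OF \<omega>] \<theta>])
  have K: "0 \<le> K" using one norm_ge_zero order_trans by blast
  have E1: "1 \<le> E" by (simp add: E_def)
  have "(\<integral>s. compensated x \<theta> (Suc n) (s, \<omega>) \<partial>unit_lebesgue) =
      (\<integral>s. c (br (s, \<omega>)) * compensated x \<theta> n (T (s, \<omega>)) \<partial>unit_lebesgue)"
    by (intro Bochner_Integration.integral_cong refl)
       (simp add: compensated_def c_def v_def birkhoff_Suc algebra_simps add_divide_distrib flip: exp_add)
  also have "\<dots> = (\<Sum>i=1..N. q i \<omega> *\<^sub>R (\<integral>s. c i * compensated x \<theta> n (s, \<tau> (d i) \<omega>) \<partial>unit_lebesgue))"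
  proof (rule first_step_quenched[OF \<omega>, where G="\<lambda>i m. c i * compensated x \<theta> n m" and B="E * exp (\<theta>\<^sup>2 * (real n * b\<^sup>2) / 2)"])
    fix i m assume "m \<in> space \<mu>"
    then show "cmod (c i * compensated x \<theta> n m) \<le> E * exp (\<theta>\<^sup>2 * (real n * b\<^sup>2) / 2)"
      unfolding norm_mult using E1 by (intro mult_mono cE compensated_bounded[OF xb]) auto
  qed simp
  also have "\<dots> = (\<Sum>i=1..N. q i \<omega> *\<^sub>R (c i * W (\<tau> (d i) \<omega>)))"
    by (simp add: W_def)
  finally have "(\<integral>s. compensated x \<theta> (Suc n) (s, \<omega>) \<partial>unit_lebesgue) - 1 =
      (\<Sum>i=1..N. q i \<omega> *\<^sub>R (c i * (W (\<tau> (d i) \<omega>) - 1))) + ((\<Sum>i=1..N. q i \<omega> *\<^sub>R c i) - 1)"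
    by (simp add: right_diff_distrib scaleR_diff_right sum_subtractf)
  also have "cmod \<dots> \<le> cmod (\<Sum>i=1..N. q i \<omega> *\<^sub>R (c i * (W (\<tau> (d i) \<omega>) - 1))) + K"
    by (rule order_trans[OF norm_triangle_ineq add_left_mono[OF one]])
  also have "cmod (\<Sum>i=1..N. q i \<omega> *\<^sub>R (c i * (W (\<tau> (d i) \<omega>) - 1))) \<le> E * (real n * K * E ^ n)"
  proof -
    have "cmod (\<Sum>i=1..N. q i \<omega> *\<^sub>R (c i * (W (\<tau> (d i) \<omega>) - 1))) \<le>
        (\<Sum>i=1..N. q i \<omega> * cmod (c i * (W (\<tau> (d i) \<omega>) - 1)))"
      using q_nonneg[OF \<omega>] by (intro sum_norm_le) simp
    also have "\<dots> \<le> E * (real n * K * E ^ n)"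
    proof (rule q_average_le[OF \<omega>])
      fix i
      have "cmod (W (\<tau> (d i) \<omega>) - 1) \<le> real n * K * E ^ n"
        using Suc.IH[OF tau_space[OF \<omega>], of "d i"]
        unfolding W_def K_def E_def by (simp flip: exp_of_nat_mult)
      then show "cmod (c i * (W (\<tau> (d i) \<omega>) - 1)) \<le> E * (real n * K * E ^ n)"
        unfolding norm_mult using cE[of i] E1 by (intro mult_mono) auto
    qed
    finally show ?thesis .
  qed
  also have "E * (real n * K * E ^ n) + K \<le> real (Suc n) * K * E ^ Suc n"
    using mult_left_mono[OF one_le_power[OF E1, of "Suc n"] K] by (simp add: algebra_simps)
  also have "E ^ Suc n = exp (real (Suc n) * (\<theta>\<^sup>2 * b\<^sup>2 / 2))"
    unfolding E_def by (simp only: exp_of_nat_mult)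
  finally show ?case by (simp add: K_def)
qed

text \<open>With \<open>\<theta> = n\<^sup>-\<^sup>1\<^sup>/\<^sup>2\<close> the compensated exponential has mean \<open>1 + O(n\<^sup>-\<^sup>1\<^sup>/\<^sup>2)\<close>. Exchanging its random
  compensator for the constant \<open>exp (\<sigma>2 / 2)\<close> costs the mean deviation of the averaged conditional variance,
  which tends to zero by the ergodic theorem.\<close>
theorem characteristic_function_limit:
  assumes drift: "\<And>\<omega>. \<omega> \<in> space P \<Longrightarrow> (\<Sum>i=1..N. q i \<omega> * x i) = 0"
  defines "\<sigma>2 \<equiv> (\<integral>\<omega>. step_variance x \<omega> \<partial>P)"
  shows "(\<lambda>n. \<integral>m. iexp (birkhoff (\<lambda>i _. x i) n m / sqrt (real n)) \<partial>\<mu>) \<longlonglongrightarrow> exp (- \<sigma>2 / 2)"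
proof -
  define b where "b = (\<Sum>i=1..N. \<bar>x i\<bar>)"
  have xb: "\<bar>x i\<bar> \<le> b" if "i \<in> {1..N}" for i
    unfolding b_def using that by (intro member_le_sum) auto
  have b0: "0 \<le> b" by (simp add: b_def sum_nonneg)
  define K where "K = exp (b\<^sup>2 / 2) * (b^4 / 4 + b^3 / 6)"
  define h where "h \<omega> = step_variance x \<omega> - \<sigma>2" for \<omega>
  have [measurable]: "h \<in> borel_measurable P" unfolding h_def[abs_def] by measurable
  have v: "0 \<le> step_variance x \<omega>" "step_variance x \<omega> \<le> b\<^sup>2" if "\<omega> \<in> space P" for \<omega>
    using that xb by (auto intro: step_variance_nonneg step_variance_le)
  have v_int: "integrable P (step_variance x)"
    using v by (intro integrable_bounded[where B="b\<^sup>2"]) auto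
  have \<sigma>2: "0 \<le> \<sigma>2" "\<sigma>2 \<le> b\<^sup>2"
  proof -
    show "0 \<le> \<sigma>2" unfolding \<sigma>2_def by (intro Bochner_Integration.integral_nonneg) (rule v)
    have "\<sigma>2 \<le> (\<integral>\<omega>. b\<^sup>2 \<partial>P)" unfolding \<sigma>2_def using v v_int by (intro integral_mono) auto
    then show "\<sigma>2 \<le> b\<^sup>2" by (simp add: prob_space)
  qed
  have hb: "\<bar>h \<omega>\<bar> \<le> b\<^sup>2" if "\<omega> \<in> space P" for \<omega>
    using v[OF that] \<sigma>2 unfolding h_def by linarith
  have "(\<integral>\<omega>. h \<omega> \<partial>P) = 0"
    using v_int by (simp add: h_def \<sigma>2_def prob_space)
  then have erg: "mean_square h \<longlonglongrightarrow> 0"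
    using hb by (intro L2_ergodic_theorem) auto
  define \<chi>n where "\<chi>n n = (\<integral>m. iexp (birkhoff (\<lambda>i _. x i) n m / sqrt (real n)) \<partial>\<mu>)" for n
  have main: "cmod (\<chi>n n * exp (\<sigma>2 / 2) - 1) \<le>
      K * exp (b\<^sup>2 / 2) * (1 / sqrt (real n)) + exp (b\<^sup>2 / 2) / 2 * sqrt (mean_square h n)" if n: "1 \<le> n" for n
  proof -
    define \<theta> where "\<theta> = 1 / sqrt (real n)"
    have \<theta>: "0 \<le> \<theta>" "\<theta> \<le> 1" and \<theta>2: "real n * \<theta>\<^sup>2 = 1"
      using n by (auto simp: \<theta>_def power_divide)
    have \<theta>3: "real n * \<theta>^3 = \<theta>"
      using \<theta>2 by (simp add: power3_eq_cube power2_eq_square)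
    let ?X = "birkhoff (\<lambda>i _. x i) n" and ?Q = "birkhoff (\<lambda>_. step_variance x) n"
    have cb: "cmod (compensated x \<theta> n m) \<le> exp (b\<^sup>2 / 2)" if "m \<in> space \<mu>" for m
      using compensated_bounded[OF xb that, where \<theta>=\<theta> and n=n] \<theta>2 by (simp add: mult.assoc[symmetric] mult.commute)
    have c_int: "integrable \<mu> (compensated x \<theta> n)"
      using cb by (intro integrable_pvp) auto
    have e_int: "integrable \<mu> (\<lambda>m. iexp (\<theta> * ?X m) * exp (\<sigma>2 / 2))"
      by (intro integrable_pvp[where B="exp (\<sigma>2 / 2)"]) (auto simp: norm_mult)
    have step1: "cmod ((\<integral>m. compensated x \<theta> n m \<partial>\<mu>) - 1) \<le> K * exp (b\<^sup>2 / 2) * \<theta>"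
    proof -
      define W where "W \<omega> = (\<integral>s. compensated x \<theta> n (s, \<omega>) \<partial>unit_lebesgue)" for \<omega>
      have [measurable]: "W \<in> borel_measurable P"
        unfolding W_def[abs_def] by (rule quenched_measurable) measurable
      have Wb: "cmod (W \<omega> - 1) \<le> K * exp (b\<^sup>2 / 2) * \<theta>" if "\<omega> \<in> space P" for \<omega>
      proof -
        have "cmod (W \<omega> - 1) \<le> real n * (K * \<theta>^3) * exp (real n * (\<theta>\<^sup>2 * b\<^sup>2 / 2))"
          unfolding W_def K_def by (rule compensated_quenched[OF xb drift \<theta> that])
        also have "real n * (\<theta>\<^sup>2 * b\<^sup>2 / 2) = b\<^sup>2 / 2" using \<theta>2 by (simp add: mult.assoc[symmetric])
        also have "real n * (K * \<theta>^3) = K * \<theta>" using \<theta>3 by (simp add: mult.left_commute)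
        finally show ?thesis by (simp add: mult_ac)
      qed
      have Wn: "cmod (W \<omega>) \<le> exp (b\<^sup>2 / 2)" if "\<omega> \<in> space P" for \<omega>
        unfolding W_def using cb that by (intro quenched_bounded) auto
      have W_int: "integrable P W"
        using Wn by (intro integrable_const_bound[where B="exp (b\<^sup>2 / 2)"]) auto
      have "(\<integral>m. compensated x \<theta> n m \<partial>\<mu>) - 1 = (\<integral>\<omega>. W \<omega> - 1 \<partial>P)"
        using W_int integral_pvp[OF c_int, folded W_def] by (simp add: prob_space)
      also have "cmod \<dots> \<le> (\<integral>\<omega>. cmod (W \<omega> - 1) \<partial>P)" by (rule integral_norm_bound)
      also have "\<dots> \<le> (\<integral>\<omega>. K * exp (b\<^sup>2 / 2) * \<theta> \<partial>P)"
        using W_int Wb by (intro integral_mono) auto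
      also have "\<dots> = K * exp (b\<^sup>2 / 2) * \<theta>" by (simp add: prob_space)
      finally show ?thesis .
    qed
    have h2_int: "integrable \<mu> (\<lambda>m. (birkhoff (\<lambda>_. h) n m)\<^sup>2)"
      using hb by (auto intro!: integrable_birkhoff_square[where B="b\<^sup>2"])
    have h1: "\<bar>birkhoff (\<lambda>_. h) n m\<bar> \<le> real n * b\<^sup>2" if "m \<in> space \<mu>" for m
      using birkhoff_bounded[where \<psi>="\<lambda>_. h", OF hb that] .
    have h1_int: "integrable \<mu> (\<lambda>m. \<bar>birkhoff (\<lambda>_. h) n m\<bar>)"
      using h1 by (intro integrable_pvp[where B="real n * b\<^sup>2"]) auto
    have diff: "cmod (iexp (\<theta> * ?X m) * exp (\<sigma>2 / 2) - compensated x \<theta> n m) \<le>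
        exp (b\<^sup>2 / 2) / 2 * (\<bar>birkhoff (\<lambda>_. h) n m\<bar> / real n)" if m: "m \<in> space \<mu>" for m
    proof -
      have Q: "0 \<le> ?Q m" "?Q m \<le> real n * b\<^sup>2"
      proof -
        show "?Q m \<le> real n * b\<^sup>2"
          using birkhoff_bounded[where \<psi>="\<lambda>_. step_variance x" and B="b\<^sup>2" and n=n, OF _ m] v by fastforce
        show "0 \<le> ?Q m" unfolding birkhoff_def
          using T_funpow_space[OF m] by (intro sum_nonneg v) (auto simp: space_pvp mem_Times_iff)
      qed
      have hQ: "birkhoff (\<lambda>_. h) n m = ?Q m - real n * \<sigma>2"
        by (simp add: birkhoff_def h_def sum_subtractf)
      define y where "y = \<theta>\<^sup>2 * ?Q m / 2"
      have yn: "y = ?Q m / real n / 2" using n by (simp add: y_def \<theta>_def power_divide)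
      have y: "y \<le> b\<^sup>2 / 2" using Q n by (simp add: yn divide_le_eq mult.commute)
      (* Both exponents are at most b^2 / 2, so the exponential is Lipschitz where it is used. *)
      have lip: "\<bar>exp s - exp t\<bar> \<le> exp (b\<^sup>2 / 2) * \<bar>s - t\<bar>" if "s \<le> b\<^sup>2 / 2" "t \<le> b\<^sup>2 / 2" for s t :: real
      proof -
        have *: "exp s - exp t \<le> exp (b\<^sup>2 / 2) * \<bar>s - t\<bar>" if "t \<le> s" "s \<le> b\<^sup>2 / 2" for s t :: real
        proof -
          have "1 + (t - s) \<le> exp (t - s)" by (rule exp_ge_add_one_self)
          then have "exp s * (1 + (t - s)) \<le> exp s * exp (t - s)" by (intro mult_left_mono) auto
          then have "exp s - exp t \<le> exp s * (s - t)" by (simp add: algebra_simps flip: exp_add)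
          also have "\<dots> \<le> exp (b\<^sup>2 / 2) * (s - t)" using that by (intro mult_right_mono) auto
          finally show ?thesis using that by simp
        qed
        show ?thesis using *[of t s] *[of s t] that
          by (cases "t \<le> s") (auto simp: abs_minus_commute)
      qed
      have "compensated x \<theta> n m = iexp (\<theta> * ?X m) * exp y"
        by (simp add: compensated_def y_def exp_add exp_of_real[symmetric])
      then have "cmod (iexp (\<theta> * ?X m) * exp (\<sigma>2 / 2) - compensated x \<theta> n m) =
          cmod (iexp (\<theta> * ?X m) * of_real (exp (\<sigma>2 / 2) - exp y))"
        by (simp add: right_diff_distrib)
      also have "\<dots> = \<bar>exp (\<sigma>2 / 2) - exp y\<bar>" by (simp add: norm_mult del: of_real_diff)
      also have "\<dots> \<le> exp (b\<^sup>2 / 2) * \<bar>\<sigma>2 / 2 - y\<bar>" using \<sigma>2 y by (intro lip) auto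
      also have "\<bar>\<sigma>2 / 2 - y\<bar> = \<bar>birkhoff (\<lambda>_. h) n m\<bar> / real n / 2"
      proof -
        have "\<sigma>2 / 2 - y = - birkhoff (\<lambda>_. h) n m / real n / 2"
          using n by (simp add: hQ yn diff_divide_distrib)
        then show ?thesis by (simp add: abs_divide)
      qed
      finally show ?thesis by simp
    qed
    have "cmod ((\<integral>m. iexp (\<theta> * ?X m) * exp (\<sigma>2 / 2) \<partial>\<mu>) - (\<integral>m. compensated x \<theta> n m \<partial>\<mu>)) =
        cmod (\<integral>m. iexp (\<theta> * ?X m) * exp (\<sigma>2 / 2) - compensated x \<theta> n m \<partial>\<mu>)"
      using e_int c_int by simp
    also have "\<dots> \<le> (\<integral>m. cmod (iexp (\<theta> * ?X m) * exp (\<sigma>2 / 2) - compensated x \<theta> n m) \<partial>\<mu>)"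
      by (rule integral_norm_bound)
    also have "\<dots> \<le> (\<integral>m. exp (b\<^sup>2 / 2) / 2 * (\<bar>birkhoff (\<lambda>_. h) n m\<bar> / real n) \<partial>\<mu>)"
      using e_int c_int h1_int by (intro integral_mono diff) auto
    also have "\<dots> = exp (b\<^sup>2 / 2) / 2 * ((\<integral>m. \<bar>birkhoff (\<lambda>_. h) n m\<bar> \<partial>\<mu>) / real n)"
      by simp
    also have "\<dots> \<le> exp (b\<^sup>2 / 2) / 2 * sqrt (mean_square h n)"
    proof (intro mult_left_mono)
      have "(\<integral>m. \<bar>birkhoff (\<lambda>_. h) n m\<bar> \<partial>\<mu>)\<^sup>2 \<le> (\<integral>m. (birkhoff (\<lambda>_. h) n m)\<^sup>2 \<partial>\<mu>)"
        using skew.variance_positive[of "\<lambda>m. \<bar>birkhoff (\<lambda>_. h) n m\<bar>"]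
          skew.variance_eq[of "\<lambda>m. \<bar>birkhoff (\<lambda>_. h) n m\<bar>"] h1_int h2_int by simp
      then have "(\<integral>m. \<bar>birkhoff (\<lambda>_. h) n m\<bar> \<partial>\<mu>) \<le> sqrt (\<integral>m. (birkhoff (\<lambda>_. h) n m)\<^sup>2 \<partial>\<mu>)"
        by (rule real_le_rsqrt)
      then show "(\<integral>m. \<bar>birkhoff (\<lambda>_. h) n m\<bar> \<partial>\<mu>) / real n \<le> sqrt (mean_square h n)"
        by (simp add: mean_square_def real_sqrt_divide divide_right_mono)
    qed simp
    finally have step2: "cmod ((\<integral>m. iexp (\<theta> * ?X m) * exp (\<sigma>2 / 2) \<partial>\<mu>) - (\<integral>m. compensated x \<theta> n m \<partial>\<mu>))
        \<le> exp (b\<^sup>2 / 2) / 2 * sqrt (mean_square h n)" .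
    have "\<chi>n n * exp (\<sigma>2 / 2) = (\<integral>m. iexp (\<theta> * ?X m) * exp (\<sigma>2 / 2) \<partial>\<mu>)"
      by (simp add: \<chi>n_def \<theta>_def)
    then have "\<chi>n n * exp (\<sigma>2 / 2) - 1 =
        ((\<integral>m. compensated x \<theta> n m \<partial>\<mu>) - 1) +
        ((\<integral>m. iexp (\<theta> * ?X m) * exp (\<sigma>2 / 2) \<partial>\<mu>) - (\<integral>m. compensated x \<theta> n m \<partial>\<mu>))"
      by simp
    also have "cmod \<dots> \<le> K * exp (b\<^sup>2 / 2) * \<theta> + exp (b\<^sup>2 / 2) / 2 * sqrt (mean_square h n)"
      by (rule order_trans[OF norm_triangle_ineq add_mono[OF step1 step2]])
    finally show ?thesis by (simp add: \<theta>_def)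
  qed
  have "(\<lambda>n. K * exp (b\<^sup>2 / 2) * (1 / sqrt (real n)) + exp (b\<^sup>2 / 2) / 2 * sqrt (mean_square h n))
      \<longlonglongrightarrow> K * exp (b\<^sup>2 / 2) * 0 + exp (b\<^sup>2 / 2) / 2 * sqrt 0"
  proof (intro tendsto_intros erg)
    have "(\<lambda>n. sqrt (inverse (real n))) \<longlonglongrightarrow> sqrt 0" by (intro tendsto_intros lim_inverse_n)
    then show "(\<lambda>n. 1 / sqrt (real n)) \<longlonglongrightarrow> 0" by (simp add: inverse_eq_divide real_sqrt_divide)
  qed
  then have lim0: "(\<lambda>n. K * exp (b\<^sup>2 / 2) * (1 / sqrt (real n)) + exp (b\<^sup>2 / 2) / 2 * sqrt (mean_square h n))
      \<longlonglongrightarrow> 0" by simp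
  have "(\<lambda>n. \<chi>n n * exp (\<sigma>2 / 2) - 1) \<longlonglongrightarrow> 0"
    by (rule Lim_null_comparison[OF _ lim0]) (use main in \<open>auto simp: eventually_sequentially\<close>)
  then have "(\<lambda>n. (\<chi>n n * exp (\<sigma>2 / 2) - 1 + 1) * exp (- \<sigma>2 / 2)) \<longlonglongrightarrow> (0 + 1) * complex_of_real (exp (- \<sigma>2 / 2))"
    by (intro tendsto_intros)
  moreover have "(\<chi>n n * exp (\<sigma>2 / 2) - 1 + 1) * exp (- \<sigma>2 / 2) = \<chi>n n" for n
  proof -
    have "exp (\<sigma>2 / 2) * exp (- \<sigma>2 / 2) = 1" by (simp flip: exp_add)
    then have "complex_of_real (exp (\<sigma>2 / 2)) * complex_of_real (exp (- \<sigma>2 / 2)) = 1"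
      by (simp only: of_real_mult[symmetric] of_real_1)
    then show ?thesis by (simp only: diff_add_cancel mult.assoc mult_1_right)
  qed
  ultimately have "\<chi>n \<longlonglongrightarrow> complex_of_real (exp (- \<sigma>2 / 2))"
    by (simp only: add_0 mult_1_left)
  then show ?thesis by (simp only: \<chi>n_def[abs_def])
qed

lemma real_vec_add: "real_vec (y + z) = real_vec y + real_vec z"
  by (simp add: real_vec_def vec_eq_iff)

lemma real_vec_zero: "real_vec 0 = 0"
  by (simp add: real_vec_def vec_eq_iff)

lemma real_vec_sum: "real_vec (sum f A) = (\<Sum>k\<in>A. real_vec (f k))"
  by (induction A rule: infinite_finite_induct) (simp_all add: real_vec_add real_vec_zero)

lemma real_vec_walk:
  "real_vec (walk \<tau> p d N n m) = (\<Sum>k<n. real_vec (d (br ((T ^^ k) m))))"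
  by (simp add: walk_def real_vec_sum displacement_def)

lemma inner_walk: "u \<bullet> real_vec (walk \<tau> p d N n m) = birkhoff (\<lambda>i _. u \<bullet> real_vec (d i)) n m"
  by (simp add: real_vec_walk birkhoff_def inner_sum_right)

lemma walk_measurable [measurable]: "(\<lambda>m. real_vec (walk \<tau> p d N n m)) \<in> borel_measurable \<mu>"
proof -
  have "(\<lambda>m. real_vec (d (br m))) \<in> borel_measurable \<mu>"
    by (rule measurable_compose[OF branch_measurable]) simp
  then show ?thesis
    unfolding real_vec_walk
    by (intro borel_measurable_sum measurable_compose[OF T_funpow_measurable])
qed

lemma drift_projection:
  assumes "\<omega> \<in> space P"
  shows "(\<Sum>i=1..N. q i \<omega> * (u \<bullet> real_vec (d i))) = 0"
proof -
  have "(\<Sum>i=1..N. q i \<omega> * (u \<bullet> real_vec (d i))) = u \<bullet> (\<Sum>i=1..N. q i \<omega> *\<^sub>R real_vec (d i))"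
    by (simp add: inner_sum_right)
  then show ?thesis by (simp only: sum_q_drift[OF assms] inner_zero_right)
qed

lemma q_integrable: "i \<in> {1..N} \<Longrightarrow> integrable P (q i)"
  using q_nonneg q_le_1 by (intro integrable_bounded[where B=1]) auto

text \<open>For the components of the displacement this expresses \<open>C\<close> through the mean transition
  probabilities.\<close>
lemma integral_branch:
  fixes f :: "nat \<Rightarrow> real"
  shows "(\<integral>m. f (br m) \<partial>\<mu>) = (\<Sum>i=1..N. (\<integral>\<omega>. q i \<omega> \<partial>P) * f i)"
proof -
  define B where "B = (\<Sum>i=1..N. \<bar>f i\<bar>)"
  have fB: "\<bar>f i\<bar> \<le> B" if "i \<in> {1..N}" for i
    unfolding B_def using that by (intro member_le_sum) auto
  have "(\<lambda>m. f (br m)) \<in> borel_measurable \<mu>"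
    by (rule measurable_compose[OF branch_measurable]) simp
  then have "integrable \<mu> (\<lambda>m. f (br m))"
    using fB[OF branch_props(1)] by (intro integrable_pvp[where B=B]) auto
  then have "(\<integral>m. f (br m) \<partial>\<mu>) = (\<integral>\<omega>. (\<integral>s. f (br (s, \<omega>)) \<partial>unit_lebesgue) \<partial>P)"
    by (rule integral_pvp)
  also have "\<dots> = (\<integral>\<omega>. (\<Sum>i=1..N. q i \<omega> * f i) \<partial>P)"
    using first_step_quenched[where G="\<lambda>i m. f i" and B=B] fB
    by (intro Bochner_Integration.integral_cong refl) (simp add: unit.prob_space space_restrict_space)
  also have "\<dots> = (\<Sum>i=1..N. (\<integral>\<omega>. q i \<omega> \<partial>P) * f i)"
    using q_integrable by (subst Bochner_Integration.integral_sum) auto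
  finally show ?thesis .
qed

theorem central_limit_theorem_walk:
  assumes C_def: "C = (\<chi> \<alpha> \<beta>. \<integral>m. real_vec (displacement p d N m) $ \<alpha> *
    real_vec (displacement p d N m) $ \<beta> \<partial>\<mu>)"
  shows "\<exists>G. gaussian_law G \<and> mean_vector G = 0 \<and> covariance_matrix G = C \<and>
    converges_weakly
      (\<lambda>n. distr \<mu> borel (\<lambda>m. (1 / sqrt (real n)) *\<^sub>R real_vec (walk \<tau> p d N n m))) G"
proof -
  define w where "w i = (\<integral>\<omega>. q i \<omega> \<partial>P)" for i
  define V where "V u = (\<Sum>i=1..N. w i * (u \<bullet> real_vec (d i))\<^sup>2)" for u
  define \<nu> where "\<nu> n = distr \<mu> borel (\<lambda>m. (1 / sqrt (real n)) *\<^sub>R real_vec (walk \<tau> p d N n m))" for n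
  have w: "0 \<le> w i" for i
    unfolding w_def by (intro Bochner_Integration.integral_nonneg) (rule q_nonneg)
  have V: "0 \<le> V u" for u unfolding V_def using w by (intro sum_nonneg) auto
  have V_variance: "V u = (\<integral>\<omega>. step_variance (\<lambda>i. u \<bullet> real_vec (d i)) \<omega> \<partial>P)" for u
    unfolding V_def w_def step_variance_def using q_integrable
    by (subst Bochner_Integration.integral_sum) auto
  obtain G where G: "prob_space G" "sets G = sets borel"
    and proj: "\<And>u. distr G borel (\<lambda>x. u \<bullet> x) = normal_law 0 (sqrt (V u))"
    using gaussian_law_exists[of "{1..N}" w "\<lambda>i. real_vec (d i)"] w unfolding V_def by blast
  note normal = projections_normal[OF G proj V]
  have "(V (axis \<alpha> 1 + axis \<beta> 1) - V (axis \<alpha> 1 - axis \<beta> 1)) / 4 = C $ \<alpha> $ \<beta>" for \<alpha> \<beta>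
  proof -
    have "V (axis \<alpha> 1 + axis \<beta> 1) - V (axis \<alpha> 1 - axis \<beta> 1) =
        (\<Sum>i=1..N. 4 * (w i * (real_vec (d i) $ \<alpha> * real_vec (d i) $ \<beta>)))"
      unfolding V_def sum_subtractf[symmetric]
      by (intro sum.cong refl)
         (simp add: inner_add_left inner_diff_left inner_axis' power2_eq_square algebra_simps)
    then show ?thesis
      using integral_branch[of "\<lambda>i. real_vec (d i) $ \<alpha> * real_vec (d i) $ \<beta>"]
      by (simp add: C_def displacement_def w_def flip: sum_distrib_left)
  qed
  then have cov: "covariance_matrix G = C"
    unfolding normal(3) by (simp add: vec_eq_iff)
  have \<nu>_prob: "prob_space (\<nu> n)" for n
    unfolding \<nu>_def by (intro skew.prob_space_distr) measurable
  have char: "(\<lambda>n. \<integral>x. iexp (u \<bullet> x) \<partial>\<nu> n) \<longlonglongrightarrow> (\<integral>x. iexp (u \<bullet> x) \<partial>G)" for u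
  proof -
    have "(\<integral>x. iexp (u \<bullet> x) \<partial>\<nu> n) =
        (\<integral>m. iexp (birkhoff (\<lambda>i _. u \<bullet> real_vec (d i)) n m / sqrt (real n)) \<partial>\<mu>)" for n
      unfolding \<nu>_def by (subst integral_distr) (simp_all add: inner_walk)
    then show ?thesis
      using characteristic_function_limit[OF drift_projection, of u]
      by (simp add: normal(5) V_variance)
  qed
  define M where "M = (\<Sum>\<alpha>\<in>UNIV. \<integral>m. (axis \<alpha> 1 \<bullet> real_vec (d (br m)))\<^sup>2 \<partial>\<mu>)"
  (* The rescaled walk has the same second moment at all times n \<ge> 1; at n = 0 it still is at the origin. *)
  have moment: "has_bochner_integral (\<nu> n) (\<lambda>x. (norm x)\<^sup>2) (M * (if n = 0 then 0 else 1))" for n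
  proof -
    have component: "has_bochner_integral \<mu> (\<lambda>m. (birkhoff (\<lambda>i _. axis \<alpha> 1 \<bullet> real_vec (d i)) n m)\<^sup>2)
        (real n * (\<integral>m. (axis \<alpha> 1 \<bullet> real_vec (d (br m)))\<^sup>2 \<partial>\<mu>))" for \<alpha>
    proof -
      let ?x = "\<lambda>i. axis \<alpha> 1 \<bullet> real_vec (d i)"
      have b: "\<bar>?x i\<bar> \<le> (\<Sum>i=1..N. \<bar>?x i\<bar>)" if "i \<in> {1..N}" for i
        using that by (intro member_le_sum) auto
      show ?thesis
        unfolding has_bochner_integral_iff
        using martingale_second_moment[of "\<lambda>i _. ?x i", OF _ b drift_projection]
          integrable_birkhoff_square[of "\<lambda>i _. ?x i", OF _ b] by simp
    qed
    have norm_eq: "(norm ((1 / sqrt (real n)) *\<^sub>R real_vec (walk \<tau> p d N n m)))\<^sup>2 =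
        (1 / real n) * (\<Sum>\<alpha>\<in>UNIV. (birkhoff (\<lambda>i _. axis \<alpha> 1 \<bullet> real_vec (d i)) n m)\<^sup>2)" for m
    proof -
      have "(norm z)\<^sup>2 = (\<Sum>\<alpha>\<in>UNIV. (axis \<alpha> 1 \<bullet> z)\<^sup>2)" for z :: "real ^ 'd"
        by (simp add: norm_vec_def L2_set_def sum_nonneg inner_axis')
      then show ?thesis
        by (simp add: power_mult_distrib power_divide flip: inner_walk)
    qed
    have "has_bochner_integral \<mu> (\<lambda>m. (norm ((1 / sqrt (real n)) *\<^sub>R real_vec (walk \<tau> p d N n m)))\<^sup>2)
        ((1 / real n) * (\<Sum>\<alpha>\<in>UNIV. real n * (\<integral>m. (axis \<alpha> 1 \<bullet> real_vec (d (br m)))\<^sup>2 \<partial>\<mu>)))"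
      unfolding norm_eq
      by (intro has_bochner_integral_mult_right has_bochner_integral_sum component)
    also have "(1 / real n) * (\<Sum>\<alpha>\<in>UNIV. real n * (\<integral>m. (axis \<alpha> 1 \<bullet> real_vec (d (br m)))\<^sup>2 \<partial>\<mu>)) =
        M * (if n = 0 then 0 else 1)"
      by (simp add: M_def flip: sum_distrib_left)
    finally show ?thesis
      unfolding \<nu>_def by (intro has_bochner_integral_distr) measurable
  qed
  have M: "0 \<le> M" by (simp add: M_def sum_nonneg)
  have "converges_weakly \<nu> G"
  proof (rule converges_weaklyI_char[OF \<nu>_prob G(1) _ G(2) char])
    show "integrable (\<nu> n) (\<lambda>x. (norm x)\<^sup>2)" for n
      using moment[of n] by (simp add: has_bochner_integral_iff)
    show "(\<integral>x. (norm x)\<^sup>2 \<partial>\<nu> n) \<le> max M (\<integral>x. (norm x)\<^sup>2 \<partial>G)" for n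
      using moment[of n] M by (auto simp: has_bochner_integral_iff split: if_splits)
  qed (simp_all add: \<nu>_def normal(4))
  then show ?thesis
    using normal(1,2) cov unfolding \<nu>_def by blast
qed

end

theorem theorem3p6:
  fixes P :: "'w measure"
    and \<tau> :: "int ^ 'd \<Rightarrow> 'w \<Rightarrow> 'w"
    and p :: "'w \<Rightarrow> int ^ 'd \<Rightarrow> int ^ 'd \<Rightarrow> real"
    and \<Lambda> :: "(int ^ 'd) set"
    and d :: "nat \<Rightarrow> int ^ 'd" and N :: nat
    and C :: "real ^ 'd ^ 'd"
  assumes env: "random_environment P \<tau> p \<Lambda>"
    and enum: "bij_betw d {1..N} \<Lambda>"
    and C_def: "C = (\<chi> \<alpha> \<beta>. \<integral>m. real_vec (displacement p d N m) $ \<alpha> *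
                                   real_vec (displacement p d N m) $ \<beta> \<partial>pvp_measure P)"
  shows "\<exists>G. gaussian_law G \<and> mean_vector G = 0 \<and> covariance_matrix G = C \<and>
           converges_weakly
             (\<lambda>n. distr (pvp_measure P) borel
                    (\<lambda>m. (1 / sqrt (real n)) *\<^sub>R real_vec (walk \<tau> p d N n m))) G"
proof -
  interpret particle_view P \<tau> p \<Lambda> d N
    using env enum by (intro particle_view.intro particle_view_axioms.intro)
  show ?thesis using C_def by (rule central_limit_theorem_walk)
qed

end
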